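(* Let $D:=mN$, let $\mathcal I^{D}:=[0,T]^{D}\times\mathcal B^{D}\times\mathbb P^{D}$, and let $\overline{x}\in\mathbb R^d$. Suppose that for every $\varepsilon>0$ one has $\overline{x}\in\mathcal X_\varepsilon$, where $\mathcal X_\varepsilon=\{y\in\mathbb R^d : V(y,\varepsilon)<+\infty\}$, and that the strict feasibility condition stated in the context holds for $\overline x$. For $\varepsilon>0$ consider the maximization problem $$\sup_{(\mathfrak t,\mathfrak b,\mathfrak p)\in\mathcal I^{D}} G_p(\overline{x},\varepsilon;\mathfrak t,\mathfrak b,\mathfrak p).$$ Then: (1) for every $\varepsilon>0$, the function $\mathcal I^D\ni(\mathfrak t,\mathfrak b,\mathfrak p)\mapsto G_p(\overline x,\varepsilon;\mathfrak t,\mathfrak b,\mathfrak p)$ is continuous, and there exists $(\mathfrak t^{*}(\overline x,\varepsilon),\mathfrak b^{*}(\overline x,\varepsilon),\mathfrak p^{*}(\overline x,\varepsilon))\in\mathcal I^D$ that solves this maximization problem; (2) for every $\varepsilon>0$, $$V(\overline{x},\varepsilon)=G_p\bigl(\overline{x},\varepsilon;\mathfrak t^{*}(\overline x,\varepsilon),\mathfrak b^{*}(\overline x,\varepsilon),\mathfrak p^{*}(\overline x,\varepsilon)\bigr);$$ (3) the family $(\Theta^{*}_{\overline x,\varepsilon})_{\varepsilon>0}$, where $\Theta^{*}_{\overline x,\varepsilon}$ is the minimizer of $\Theta\mapsto J(\Theta)+\varepsilon R(\Theta)$ over all $\Theta\in\mathcal A$ satisfying the constraints of the relaxed problem defining $G_p(\overline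 x,\varepsilon;\mathfrak t,\mathfrak b,\mathfrak p)$ at $(\mathfrak t,\mathfrak b,\mathfrak p)=(\mathfrak t^{*}(\overline x,\varepsilon),\mathfrak b^{*}(\overline x,\varepsilon),\mathfrak p^{*}(\overline x,\varepsilon))$, converges as $\varepsilon\downarrow 0$ to an optimizer of the unregularized program $$\inf_{\Theta\in\mathcal A}\ J(\Theta)\quad\text{subject to}\quad x(t;\overline x,\Theta,\beta,p)\in\mathbb X,\ x(T;\overline x,\Theta,\beta,p)\in X_F,\ \Theta\Psi(t)\in\mathbb U\ \text{ for all }(t,\beta,p)\in[0,T]\times\mathcal B\times\mathbb P.$$
   Context: System and constraint data. Let $d,m,\nu\in\mathbb N$, $T>0$, let $\mathbb P\subset\mathbb R^\nu$ be nonempty, compact and convex, and let $p\mapsto A(p)\in\mathbb R^{d\times d}$ and $p\mapsto B(p)\in\mathbb R^{d\times m}$ be continuous on $\mathbb P$. Consider $\dot x(t)=A(p)x(t)+B(p)u(t)+w(t)$ for $t\in[0,T]$, $x(0)=\overline x\in\mathbb R^d$. Let $\mathbb U=\prod_{i=1}^m[-\bar u^i,\bar u^i]\subset\mathbb R^m$ with each $\bar u^i>0$, and $\mathbb W=\prod_{j=1}^d[-\bar w^j,\bar w^j]\subset\mathbb R^d$ with each $\bar w^j>0$. Let $\mathbb X\subset\mathbb R^d$ be compact and convex with $0$ in its interior, and let $X_F\subset\mathbb X$ be compact and convex with $0$ in its interior. Piecewise constant functions. Fix $h>0$ and a uniform partition $0=t_0<\cdots<t_K\le T$ with $t_k-t_{k-1}=h$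 for $k=1,\dots,K$ and $T-t_K\le h$. $\mathrm{PC}_h([0,T];\mathbb R)$ is the set of functions $y:[0,T]\to\mathbb R$ that are constant on each $[t_{k-1},t_k)$, $k=1,\dots,K$, and constant on $[t_K,T]$. Parametrization. Let $N,M\in\mathbb N$; let $\psi_1,\dots,\psi_N\in\mathrm{PC}_h([0,T];\mathbb R)$ be linearly independent with $\max_i\max_t|\psi_i(t)|=1$, and let $\varphi_1,\dots,\varphi_M\in\mathrm{PC}_h([0,T];\mathbb R)$ be linearly independent with $\max_j\max_t|\varphi_j(t)|=1$. Put $\Psi(t)=(\psi_1(t),\dots,\psi_N(t))^{\top}\in\mathbb R^N$ and $\Phi(t)=(\varphi_1(t),\dots,\varphi_M(t))^{\top}\in\mathbb R^M$. Controls are $u(t)=\Theta\Psi(t)$ with $\Theta\in\mathbb R^{m\times N}$, and disturbances are $w(t)=\beta\Phi(t)$ with $\beta\in\mathbb R^{d\times M}$. Admissible parameter sets: $$\mathcal A=\{\Theta\in\mathbb R^{m\times N}:\Theta\Psi(t)\in\mathbb U\ \forall t\in[0,T]\},\qquad \mathcal B=\{\beta\in\mathbb R^{d\times M}:\beta\Phi(t)\in\mathbb W\ \forall t\in[0,T]\}.$$ The state trajectory is $$x(t;\overline x,\Theta,\beta,p)=e^{A(p)t}\overline x+\int_0^t e^{A(p)(t-\tau)}\bigl(B(p)\Theta\Psi(\tau)+\beta\Phi(\tau)\bigr)\,d\tau .$$ Objective. With $\Psi_{k-1}$ the value of $\Psi$ on $[t_{k-1},t_k)$ ($k=1,\dots,K$)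 and $\Psi_K$ its value on $[t_K,T]$, $$J(\Theta)=\int_0^T\|\Theta\Psi(t)\|_{\ell_1}\,dt=\sum_{k=1}^K h\|\Theta\Psi_{k-1}\|_{\ell_1}+(T-t_K)\|\Theta\Psi_K\|_{\ell_1}.$$ $R:\mathbb R^{m\times N}\to\mathbb R$ is a continuous, positive, strictly convex function. Regularized program. $V(\overline x,\varepsilon)$ is the optimal value ($+\infty$ if infeasible) of $$\inf_{\Theta\in\mathcal A}\ J(\Theta)+\varepsilon R(\Theta)\quad\text{s.t. } x(t;\overline x,\Theta,\beta,p)\in\mathbb X,\ x(T;\overline x,\Theta,\beta,p)\in X_F,\ \Theta\Psi(t)\in\mathbb U\ \ \forall (t,\beta,p)\in[0,T]\times\mathcal B\times\mathbb P.$$ Relaxed program. For $\mathfrak t=(t^1,\dots,t^D)\in[0,T]^D$, $\mathfrak b=(\beta^1,\dots,\beta^D)\in\mathcal B^D$, $\mathfrak p=(p^1,\dots,p^D)\in\mathbb P^D$ with $D=mN$, $G_p(\overline x,\varepsilon;\mathfrak t,\mathfrak b,\mathfrak p)$ is the optimal value of $$\inf_{\Theta\in\mathcal A}\ J(\Theta)+\varepsilon R(\Theta)\quad\text{s.t. } x(t^i;\overline x,\Theta,\beta^i,p^i)\in\mathbb X,\ x(T;\overline x,\Theta,\beta^i,p^i)\in X_F,\ \Theta\Psi(t^i)\in\mathbb U,\ \ i=1,\dots,D.$$ Strict feasibility condition. There exist $\Theta$ and a nonempty open set $O\subset\operatorname{int}\mathbb X\times\operatorname{int}\mathbb U$ such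 that $(x(t;\overline x,\Theta,\beta,p),\Theta\Psi(t))\in O$ and $x(T;\overline x,\Theta,\beta,p)\in\operatorname{int}X_F$ for all $\beta\in\mathcal B$, all $p\in\mathbb P$ and all $t\in[0,T]$. *)

theory Defs
  imports "HOL-Analysis.Analysis"
begin

text \<open>
  The matrix exponential is spelled out because \<^term>\<open>exp\<close> needs a normed algebra: on
  \<^typ>\<open>real^'n^'n\<close> the class operations for multiplication, unit and powers are componentwise,
  whereas the matrix product is \<open>**\<close> with unit \<open>mat 1\<close>.
\<close>

definition mat_power :: "real^'n^'n \<Rightarrow> nat \<Rightarrow> real^'n^'n" where
  "mat_power A k = ((\<lambda>C. A ** C) ^^ k) (mat 1)"

definition mat_exp :: "real^'n^'n \<Rightarrow> real^'n^'n" where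
  "mat_exp A = (\<Sum>k. (1 / fact k) *\<^sub>R mat_power A k)"

definition l1_norm :: "real^'n \<Rightarrow> real" where
  "l1_norm v = (\<Sum>i\<in>UNIV. \<bar>v $ i\<bar>)"

definition strictly_convex :: "('a::real_vector \<Rightarrow> real) \<Rightarrow> bool" where
  "strictly_convex f \<longleftrightarrow>
     (\<forall>x y u. x \<noteq> y \<longrightarrow> 0 < u \<longrightarrow> u < 1 \<longrightarrow>
        f ((1 - u) *\<^sub>R x + u *\<^sub>R y) < (1 - u) * f x + u * f y)"

text \<open>
  Piecewise constant functions for the partition \<open>t\<^sub>k = k h\<close>, \<open>k = 0,\<dots>,K\<close>. Functions on
  \<open>[0,T]\<close> are total functions whose values outside \<open>[0,T]\<close> are irrelevant.
\<close>

definition PC :: "real \<Rightarrow> nat \<Rightarrow> real \<Rightarrow> (real \<Rightarrow> real) set" where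
  "PC h K T = {y. (\<forall>k\<in>{1..K}. y constant_on {real (k - 1) * h..<real k * h}) \<and>
                  y constant_on {real K * h..T}}"

text \<open>
  A basis is a vector-valued function \<open>F\<close> with entries \<open>F\<^sub>i \<in> PC\<close>, linearly independent as
  functions on \<open>[0,T]\<close>. The maxima are over finite sets, since the entries are piecewise constant.
\<close>

definition PC_basis :: "real \<Rightarrow> nat \<Rightarrow> real \<Rightarrow> (real \<Rightarrow> real^'n) \<Rightarrow> bool" where
  "PC_basis h K T F \<longleftrightarrow>
     (\<forall>i. (\<lambda>t. F t $ i) \<in> PC h K T) \<and>
     (\<forall>c :: 'n \<Rightarrow> real. (\<forall>t\<in>{0..T}. (\<Sum>i\<in>UNIV. c i * F t $ i) = 0) \<longrightarrow> (\<forall>i. c i = 0)) \<and>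
     (MAX i. MAX t\<in>{0..T}. \<bar>F t $ i\<bar>) = 1"

text \<open>
  The dimensions \<open>d\<close>, \<open>m\<close>, \<open>\<nu>\<close>, \<open>N\<close>, \<open>M\<close> are the cardinalities of the finite index types
  \<open>'d\<close>, \<open>'m\<close>, \<open>'v\<close>, \<open>'N\<close>, \<open>'M\<close>.
\<close>

record ('d::finite, 'm::finite, 'v::finite, 'N::finite, 'M::finite) control_problem =
  horizon :: real                                 \<comment> \<open>\<open>T\<close>\<close>
  mesh :: real                                    \<comment> \<open>\<open>h\<close>\<close>
  num_steps :: nat                                \<comment> \<open>\<open>K\<close>\<close>
  params :: "(real^'v) set"                       \<comment> \<open>the parameter set of \<open>p\<close>\<close>
  mat_A :: "real^'v \<Rightarrow> real^'d^'d"
  mat_B :: "real^'v \<Rightarrow> real^'m^'d"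
  ubar :: "real^'m"
  wbar :: "real^'d"
  state_set :: "(real^'d) set"                    \<comment> \<open>the set \<open>X\<close>\<close>
  final_set :: "(real^'d) set"                    \<comment> \<open>the set \<open>X\<^sub>F\<close>\<close>
  \<Psi> :: "real \<Rightarrow> real^'N"
  \<Phi> :: "real \<Rightarrow> real^'M"
  regularizer :: "real^'N^'m \<Rightarrow> real"             \<comment> \<open>\<open>R\<close>\<close>

definition well_posed :: "('d::finite,'m::finite,'v::finite,'N::finite,'M::finite) control_problem \<Rightarrow> bool" where
  "well_posed S \<longleftrightarrow>
     0 < horizon S \<and>
     params S \<noteq> {} \<and> compact (params S) \<and> convex (params S) \<and>
     continuous_on (params S) (mat_A S) \<and> continuous_on (params S) (mat_B S) \<and>
     (\<forall>i. 0 < ubar S $ i) \<and> (\<forall>j. 0 < wbar S $ j) \<and>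
     compact (state_set S) \<and> convex (state_set S) \<and> 0 \<in> interior (state_set S) \<and>
     final_set S \<subseteq> state_set S \<and>
     compact (final_set S) \<and> convex (final_set S) \<and> 0 \<in> interior (final_set S) \<and>
     0 < mesh S \<and> real (num_steps S) * mesh S \<le> horizon S \<and>
     horizon S - real (num_steps S) * mesh S \<le> mesh S \<and>
     PC_basis (mesh S) (num_steps S) (horizon S) (\<Psi> S) \<and>
     PC_basis (mesh S) (num_steps S) (horizon S) (\<Phi> S) \<and>
     continuous_on UNIV (regularizer S) \<and> (\<forall>\<Theta>. 0 < regularizer S \<Theta>) \<and>
     strictly_convex (regularizer S)"

definition control_set :: "('d::finite,'m::finite,'v::finite,'N::finite,'M::finite) control_problem \<Rightarrow> (real^'m) set" where
  "control_set S = {v. \<forall>i. v $ i \<in> {- ubar S $ i..ubar S $ i}}"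

definition disturbance_set :: "('d::finite,'m::finite,'v::finite,'N::finite,'M::finite) control_problem \<Rightarrow> (real^'d) set" where
  "disturbance_set S = {w. \<forall>j. w $ j \<in> {- wbar S $ j..wbar S $ j}}"

definition adm_\<Theta> :: "('d::finite,'m::finite,'v::finite,'N::finite,'M::finite) control_problem \<Rightarrow> (real^'N^'m) set" where
  "adm_\<Theta> S = {\<Theta>. \<forall>t\<in>{0..horizon S}. \<Theta> *v \<Psi> S t \<in> control_set S}"

definition adm_\<beta> :: "('d::finite,'m::finite,'v::finite,'N::finite,'M::finite) control_problem \<Rightarrow> (real^'M^'d) set" where
  "adm_\<beta> S = {\<beta>. \<forall>t\<in>{0..horizon S}. \<beta> *v \<Phi> S t \<in> disturbance_set S}"

definition trajectory ::
  "('d::finite,'m::finite,'v::finite,'N::finite,'M::finite) control_problem \<Rightarrow>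
   real \<Rightarrow> real^'d \<Rightarrow> real^'N^'m \<Rightarrow> real^'M^'d \<Rightarrow> real^'v \<Rightarrow> real^'d" where
  "trajectory S t xbar \<Theta> \<beta> p =
     mat_exp (t *\<^sub>R mat_A S p) *v xbar +
     integral {0..t} (\<lambda>\<tau>. mat_exp ((t - \<tau>) *\<^sub>R mat_A S p) *v
                           (mat_B S p *v (\<Theta> *v \<Psi> S \<tau>) + \<beta> *v \<Phi> S \<tau>))"

definition cost :: "('d::finite,'m::finite,'v::finite,'N::finite,'M::finite) control_problem \<Rightarrow> real^'N^'m \<Rightarrow> real" where
  "cost S \<Theta> = integral {0..horizon S} (\<lambda>t. l1_norm (\<Theta> *v \<Psi> S t))"

definition reg_cost ::
  "('d::finite,'m::finite,'v::finite,'N::finite,'M::finite) control_problem \<Rightarrow> real \<Rightarrow> real^'N^'m \<Rightarrow> real" where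
  "reg_cost S \<epsilon> \<Theta> = cost S \<Theta> + \<epsilon> * regularizer S \<Theta>"

definition constraints_at ::
  "('d::finite,'m::finite,'v::finite,'N::finite,'M::finite) control_problem \<Rightarrow>
   real^'d \<Rightarrow> real^'N^'m \<Rightarrow> real \<Rightarrow> real^'M^'d \<Rightarrow> real^'v \<Rightarrow> bool" where
  "constraints_at S xbar \<Theta> t \<beta> p \<longleftrightarrow>
     trajectory S t xbar \<Theta> \<beta> p \<in> state_set S \<and>
     trajectory S (horizon S) xbar \<Theta> \<beta> p \<in> final_set S \<and>
     \<Theta> *v \<Psi> S t \<in> control_set S"

definition robust_feasible ::
  "('d::finite,'m::finite,'v::finite,'N::finite,'M::finite) control_problem \<Rightarrow> real^'d \<Rightarrow> (real^'N^'m) set" where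
  "robust_feasible S xbar =
     {\<Theta> \<in> adm_\<Theta> S. \<forall>t\<in>{0..horizon S}. \<forall>\<beta>\<in>adm_\<beta> S. \<forall>p\<in>params S. constraints_at S xbar \<Theta> t \<beta> p}"

text \<open>A \<open>D\<close>-tuple is a vector indexed by a type \<open>'D\<close> of cardinality \<open>D\<close>.\<close>

definition relaxed_feasible ::
  "('d::finite,'m::finite,'v::finite,'N::finite,'M::finite) control_problem \<Rightarrow> real^'d \<Rightarrow>
   real^'D \<Rightarrow> (real^'M^'d)^'D \<Rightarrow> (real^'v)^'D \<Rightarrow> (real^'N^'m) set" where
  "relaxed_feasible S xbar ts bs ps =
     {\<Theta> \<in> adm_\<Theta> S. \<forall>i. constraints_at S xbar \<Theta> (ts $ i) (bs $ i) (ps $ i)}"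

text \<open>Optimal values are extended reals; the infimum over the empty set is \<open>\<infinity>\<close>.\<close>

definition V ::
  "('d::finite,'m::finite,'v::finite,'N::finite,'M::finite) control_problem \<Rightarrow> real^'d \<Rightarrow> real \<Rightarrow> ereal" where
  "V S xbar \<epsilon> = (INF \<Theta>\<in>robust_feasible S xbar. ereal (reg_cost S \<epsilon> \<Theta>))"

definition G ::
  "('d::finite,'m::finite,'v::finite,'N::finite,'M::finite) control_problem \<Rightarrow> real^'d \<Rightarrow> real \<Rightarrow>
   real^'D \<Rightarrow> (real^'M^'d)^'D \<Rightarrow> (real^'v)^'D \<Rightarrow> ereal" where
  "G S xbar \<epsilon> ts bs ps = (INF \<Theta>\<in>relaxed_feasible S xbar ts bs ps. ereal (reg_cost S \<epsilon> \<Theta>))"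

definition index_set ::
  "('d::finite,'m::finite,'v::finite,'N::finite,'M::finite) control_problem \<Rightarrow>
   ((real^'D) \<times> ((real^'M^'d)^'D) \<times> ((real^'v)^'D)) set" where
  "index_set S = {(ts, bs, ps). \<forall>i. ts $ i \<in> {0..horizon S} \<and> bs $ i \<in> adm_\<beta> S \<and> ps $ i \<in> params S}"

definition solves_max ::
  "('d::finite,'m::finite,'v::finite,'N::finite,'M::finite) control_problem \<Rightarrow> real^'d \<Rightarrow> real \<Rightarrow>
   real^'D \<Rightarrow> (real^'M^'d)^'D \<Rightarrow> (real^'v)^'D \<Rightarrow> bool" where
  "solves_max S xbar \<epsilon> ts bs ps \<longleftrightarrow>
     is_arg_max (\<lambda>(t, b, p). G S xbar \<epsilon> t b p) (\<lambda>z. z \<in> index_set S) (ts, bs, ps)"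

definition feasible_states ::
  "('d::finite,'m::finite,'v::finite,'N::finite,'M::finite) control_problem \<Rightarrow> real \<Rightarrow> (real^'d) set" where
  "feasible_states S \<epsilon> = {y. V S y \<epsilon> < \<infinity>}"

definition strictly_feasible ::
  "('d::finite,'m::finite,'v::finite,'N::finite,'M::finite) control_problem \<Rightarrow> real^'d \<Rightarrow> bool" where
  "strictly_feasible S xbar \<longleftrightarrow>
     (\<exists>\<Theta> Q. open Q \<and> Q \<noteq> {} \<and> Q \<subseteq> interior (state_set S) \<times> interior (control_set S) \<and>
        (\<forall>\<beta>\<in>adm_\<beta> S. \<forall>p\<in>params S. \<forall>t\<in>{0..horizon S}.
           (trajectory S t xbar \<Theta> \<beta> p, \<Theta> *v \<Psi> S t) \<in> Q \<and>
           trajectory S (horizon S) xbar \<Theta> \<beta> p \<in> interior (final_set S)))"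

end

theory Submission
  imports Defs
begin

text \<open>
  The proof treats the control problem as a convex program in the coefficient matrix
  \<open>\<Theta>\<close>, an element of a real vector space of dimension \<open>D = m N\<close>. For each scenario
  \<open>(t, \<beta>, p)\<close> the pair of the states at time \<open>t\<close> and at the final time is an affine function of
  \<open>\<Theta>\<close>, jointly continuous in \<open>\<Theta>\<close> and the scenario; the constraint that it belongs to
  \<open>X \<times> X\<^sub>F\<close> therefore cuts out a closed convex set of coefficients. All admissible
  coefficients lie in a compact convex set, because the basis functions are linearly independent.
  The robust program intersects the constraint sets of all scenarios, the relaxed program those of
  \<open>D\<close> scenarios.

  Continuity of \<open>G\<close> (\<open>value_function_continuous\<close>) is a stability statement for convex
  programs. Compactness alone makes the optimal value lower semicontinuous in the scenarios. Upper
  semicontinuity comes from strict feasibility: moving an almost optimal \<open>\<Theta>\<close> slightly towards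
  the strictly feasible one makes all its constraints hold with room to spare, and they survive a
  small perturbation of the scenarios. A maximum then exists since the index set is compact.

  The maximum equals \<open>V\<close> by Helly's theorem (\<open>semi_infinite_helly\<close>). Let \<open>g\<close> be the maximum of
  \<open>G\<close>. The compact convex sublevel set of the cost at \<open>g\<close> meets every intersection of
  \<open>D\<close> constraint sets, since each relaxed program has optimal value at most \<open>g\<close>. Helly's theorem
  asks for intersections of \<open>D + 1\<close> members of the family formed by the sublevel set and the
  constraint sets; if the sublevel set is not among them, any robustly feasible point will do.
  Hence some robustly feasible \<open>\<Theta>\<close> has cost at most \<open>g\<close>.

  Because of strict convexity, the minimiser of a worst relaxed program is also the minimiser
  of the robust program: the latter is feasible for the former and has the same value. So the
  minimisers in the last claim all solve the robust program over one fixed compact convex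
  set, and the choice of the worst scenarios no longer matters. Letting \<open>\<epsilon>\<close> tend to zero is then
  Tikhonov regularization (\<open>tikhonov_convergence\<close>): the limit is the minimiser of \<open>R\<close> among the
  minimisers of the unregularized cost.
\<close>

section \<open>Value functions, minimisers and a Helly theorem for semi-infinite programs\<close>

text \<open>
  Lower semicontinuity at \<open>z0\<close> is a closed-projection argument: the parameters for which a
  feasible point of cost at most \<open>a'\<close> exists form a relatively closed set, as the projection of a
  closed set along a compact factor. Upper semicontinuity uses the Slater point \<open>s\<close>: a convex
  combination of a feasible point with \<open>s\<close> lands in the interior of \<open>C\<close>, and so stays feasible
  for nearby parameters.
\<close>

lemma value_function_continuous:
  fixes f :: "'a::euclidean_space \<Rightarrow> real"
    and y :: "'i::finite \<Rightarrow> 'a \<Rightarrow> 'b::euclidean_space \<Rightarrow> 'c::euclidean_space"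
  assumes A: "compact A" "convex A" and f: "continuous_on A f"
    and C: "closed C" "convex C"
    and y: "\<And>i. continuous_on (A \<times> Z) (\<lambda>(x, z). y i x z)"
    and aff: "\<And>i x x' z u. \<lbrakk>x \<in> A; x' \<in> A; z \<in> Z; 0 \<le> u; u \<le> 1\<rbrakk> \<Longrightarrow>
        y i ((1 - u) *\<^sub>R x + u *\<^sub>R x') z = (1 - u) *\<^sub>R y i x z + u *\<^sub>R y i x' z"
    and slater: "s \<in> A" "\<And>i z. z \<in> Z \<Longrightarrow> y i s z \<in> interior C"
  shows "continuous_on Z (\<lambda>z. INF x\<in>{x \<in> A. \<forall>i. y i x z \<in> C}. ereal (f x))" (is "continuous_on Z ?v")
  unfolding continuous_on_def
proof (intro ballI order_tendstoI)
  fix z0 a assume z0: "z0 \<in> Z" and "a < ?v z0"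
  then obtain a' where a': "a < a'" "a' < ?v z0" using dense by blast
  define K where "K = {x \<in> A. ereal (f x) \<le> a'}"
  have "continuous_on A (\<lambda>x. ereal (f x))" using f by (intro continuous_intros)
  then have "closedin (top_of_set A) (A \<inter> (\<lambda>x. ereal (f x)) -` {..a'})"
    by (intro continuous_closedin_preimage) auto
  then have K: "compact K" "K \<subseteq> A" using A(1) closedin_compact
    by (auto simp: K_def vimage_def Int_def)
  have cl: "closedin (top_of_set (K \<times> Z)) (\<Inter>i. (K \<times> Z) \<inter> (\<lambda>(x, z). y i x z) -` C)"
    by (intro closedin_INT continuous_closedin_preimage continuous_on_subset[OF y] C) (use K in auto)
  define W where "W = {z \<in> Z. \<exists>x\<in>K. \<forall>i. y i x z \<in> C}"
  have "W = {z. \<exists>x. x \<in> K \<and> (x, z) \<in> (\<Inter>i. (K \<times> Z) \<inter> (\<lambda>(x, z). y i x z) -` C)}"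
    by (auto simp: W_def)
  then have "closedin (top_of_set Z) W" using closedin_compact_projection[OF K(1) cl] by simp
  then have "openin (top_of_set Z) (Z - W)" by (simp add: openin_diff)
  then obtain N where N: "open N" "Z - W = Z \<inter> N" unfolding openin_open by blast
  have "z0 \<notin> W"
  proof
    assume "z0 \<in> W"
    then obtain x where x: "x \<in> K" "\<forall>i. y i x z0 \<in> C" by (auto simp: W_def)
    then have "?v z0 \<le> ereal (f x)" by (intro INF_lower) (use K in auto)
    with a' x show False by (auto simp: K_def)
  qed
  then have "z0 \<in> N" using N(2) z0 by blast
  show "eventually (\<lambda>z. a < ?v z) (at z0 within Z)"
    unfolding eventually_at_topological
  proof (intro exI[of _ N] conjI N(1) \<open>z0 \<in> N\<close> ballI impI)
    fix z assume z: "z \<in> N" "z \<in> Z"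
    have "a' \<le> ?v z"
    proof (rule INF_greatest)
      fix x assume x: "x \<in> {x \<in> A. \<forall>i. y i x z \<in> C}"
      have "z \<notin> W" using N(2) z by blast
      then have "x \<notin> K" using x z by (auto simp: W_def)
      then show "a' \<le> ereal (f x)" using x by (auto simp: K_def)
    qed
    with a'(1) show "a < ?v z" by simp
  qed
next
  fix z0 a assume z0: "z0 \<in> Z" and "?v z0 < a"
  then obtain x where x: "x \<in> A" "\<forall>i. y i x z0 \<in> C" "ereal (f x) < a" by (auto simp: INF_less_iff)
  define g where "g e = (1 - e) *\<^sub>R x + e *\<^sub>R s" for e :: real
  have gA: "g e \<in> A" if "e \<in> {0..1}" for e
    using that A(2) x(1) slater(1) unfolding g_def convex_alt by auto
  have "continuous_on {0..1} (\<lambda>e. ereal (f (g e)))"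
    by (intro continuous_intros continuous_on_compose2[OF f])
      (auto simp: g_def intro!: continuous_intros dest: gA[unfolded g_def])
  then have "((\<lambda>e. ereal (f (g e))) \<longlongrightarrow> ereal (f (g 0))) (at 0 within {0..1})"
    unfolding continuous_on_def by auto
  then have "eventually (\<lambda>e. ereal (f (g e)) < a) (at 0 within {0..1})"
    by (rule order_tendstoD) (use x in \<open>simp add: g_def\<close>)
  then obtain d where d: "d > 0" "\<forall>e\<in>{0..1}. e \<noteq> 0 \<and> dist e 0 < d \<longrightarrow> ereal (f (g e)) < a"
    unfolding eventually_at by auto
  define e where "e = min (d / 2) 1"
  have e: "0 < e" "e \<le> 1" "ereal (f (g e)) < a" using d unfolding e_def by (auto simp: min_def)
  have "y i (g e) z0 \<in> interior C" for i
  proof -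
    have "y i x z0 - e *\<^sub>R (y i x z0 - y i s z0) \<in> interior C"
      using x e slater(2)[OF z0] by (intro mem_interior_convex_shrink[OF C(2)]) auto
    moreover have "y i x z0 - e *\<^sub>R (y i x z0 - y i s z0) = y i (g e) z0"
      unfolding g_def using aff[of x s z0 e i] x slater z0 e by (simp add: algebra_simps)
    ultimately show ?thesis by simp
  qed
  moreover have "((\<lambda>z. y i (g e) z) \<longlongrightarrow> y i (g e) z0) (at z0 within Z)" for i
  proof -
    have "continuous_on Z (\<lambda>z. (\<lambda>(x, z). y i x z) (g e, z))"
      by (rule continuous_on_compose2[OF y]) (use gA e in \<open>auto intro!: continuous_intros\<close>)
    then show ?thesis using z0 unfolding continuous_on_def by auto
  qed
  ultimately have "eventually (\<lambda>z. y i (g e) z \<in> interior C) (at z0 within Z)" for i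
    by (intro topological_tendstoD[where f = "\<lambda>z. y i (g e) z"]) auto
  then have "eventually (\<lambda>z. \<forall>i. y i (g e) z \<in> interior C) (at z0 within Z)"
    by (rule eventually_all_finite)
  then show "eventually (\<lambda>z. ?v z < a) (at z0 within Z)"
  proof eventually_elim
    case (elim z)
    then have "?v z \<le> ereal (f (g e))"
      using interior_subset gA e by (intro INF_lower) auto
    with e show ?case by simp
  qed
qed

text \<open>
  A convex program in dimension \<open>D\<close> with infinitely many convex constraints is
  decided by \<open>D\<close> constraints at a time, one fewer than Helly's number \<open>D + 1\<close>. The
  sublevel set \<open>L\<close> of the objective takes the place of one constraint, and subfamilies without \<open>L\<close>
  are handled by the feasibility of the whole system. Compactness of \<open>L\<close> reduces the infinite
  family to finite ones.
\<close>

lemma semi_infinite_helly: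
  fixes C :: "'i \<Rightarrow> 'a::euclidean_space set"
  assumes D: "CARD('D::finite) = DIM('a)" and I: "I \<noteq> {}"
    and L: "compact L" "convex L"
    and C: "\<And>i. i \<in> I \<Longrightarrow> closed (C i)" "\<And>i. i \<in> I \<Longrightarrow> convex (C i)"
    and feasible: "(\<Inter>i\<in>I. C i) \<noteq> {}"
    and tuples: "\<And>z :: 'D \<Rightarrow> 'i. range z \<subseteq> I \<Longrightarrow> L \<inter> (\<Inter>k. C (z k)) \<noteq> {}"
  shows "L \<inter> (\<Inter>i\<in>I. C i) \<noteq> {}"
proof -
  obtain i0 where i0: "i0 \<in> I" using I by blast
  \<comment> \<open>This includes families smaller than Helly's number, to which Helly's theorem
    does not apply; repeating a constraint pads them to a full tuple.\<close>
  have sub: "\<Inter>t \<noteq> {}"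
    if t: "t \<subseteq> insert L (C ` I)" "finite t" "card t \<le> DIM('a) + 1" for t
  proof (cases "L \<in> t")
    case False
    then have "(\<Inter>i\<in>I. C i) \<subseteq> \<Inter>t" using t by blast
    with feasible show ?thesis by blast
  next
    case True
    define J where "J = t - {L}"
    have J: "finite J" "J \<subseteq> C ` I" "card J \<le> CARD('D)"
      using t True by (auto simp: J_def D)
    obtain g where g: "g ` J \<subseteq> (UNIV :: 'D set)" "inj_on g J"
      using card_le_inj[OF J(1) finite J(3)] by blast
    have "\<forall>c\<in>J. \<exists>i\<in>I. c = C i" using J by blast
    then obtain r where r: "\<And>c. c \<in> J \<Longrightarrow> r c \<in> I \<and> C (r c) = c" by metis
    \<comment> \<open>The tuple lists the at most \<open>D\<close> constraints in \<open>t\<close>; unused positions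
      hold the arbitrary constraint \<open>i0\<close>.\<close>
    define z where "z k = (if k \<in> g ` J then r (inv_into J g k) else i0)" for k
    have "range z \<subseteq> I" using r i0 by (auto simp: z_def g inv_into_into)
    then have "L \<inter> (\<Inter>k. C (z k)) \<noteq> {}" by (rule tuples)
    moreover have "L \<inter> (\<Inter>k. C (z k)) \<subseteq> \<Inter>t"
    proof (rule Inter_greatest)
      fix c assume "c \<in> t"
      show "L \<inter> (\<Inter>k. C (z k)) \<subseteq> c"
      proof (cases "c = L")
        case False
        then have "c \<in> J" using \<open>c \<in> t\<close> J_def by blast
        then have "z (g c) = r c" using g(2) by (simp add: z_def)
        then have "C (z (g c)) = c" using r \<open>c \<in> J\<close> by simp
        then show ?thesis by blast
      qed auto
    qed
    ultimately show ?thesis by blast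
  qed
  have "L \<inter> \<Inter>(C ` I) \<noteq> {}"
  proof (rule compact_imp_fip[OF L(1)])
    fix F assume F: "finite F" "F \<subseteq> C ` I"
    have "\<Inter>(insert L F) \<noteq> {}"
    proof (cases "card (insert L F) \<ge> DIM('a) + 1")
      case True
      then show ?thesis
      proof (rule Helly)
        show "\<forall>s\<in>insert L F. convex s" using F L C by auto
        fix t assume "t \<subseteq> insert L F" "card t = DIM('a) + 1"
        then show "\<Inter>t \<noteq> {}" using F
          by (intro sub) (auto intro: finite_subset)
      qed
    next
      case False
      then show ?thesis using F by (intro sub) auto
    qed
    then show "L \<inter> \<Inter>F \<noteq> {}" by simp
  qed (use C in auto)
  then show ?thesis .
qed

lemma convex_sublevel:
  assumes "convex_on A f"
  shows "convex {x \<in> A. f x \<le> (c::real)}"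
  unfolding convex_alt
proof (intro ballI allI impI, elim conjE)
  fix x y and u :: real
  assume xy: "x \<in> {x \<in> A. f x \<le> c}" "y \<in> {x \<in> A. f x \<le> c}" and u: "0 \<le> u" "u \<le> 1"
  have "f ((1 - u) *\<^sub>R x + u *\<^sub>R y) \<le> (1 - u) * f x + u * f y"
    using convex_onD[OF assms] xy u by auto
  also have "\<dots> \<le> c" using xy u by (intro convex_bound_le) auto
  finally show "(1 - u) *\<^sub>R x + u *\<^sub>R y \<in> {x \<in> A. f x \<le> c}"
    using convexD_alt[OF convex_on_imp_convex[OF assms], of x y u] xy u by simp
qed

lemma strictly_convex_argmin_unique:
  fixes f :: "'a::real_vector \<Rightarrow> real"
  assumes f: "strictly_convex f" and F: "convex F"
    and x: "is_arg_min f (\<lambda>x. x \<in> F) x" and y: "is_arg_min f (\<lambda>x. x \<in> F) y"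
  shows "x = y"
proof (rule ccontr)
  assume ne: "x \<noteq> y"
  have xy: "x \<in> F" "y \<in> F" "f x = f y"
    using x y unfolding is_arg_min_def by (auto simp: not_less intro: antisym)
  let ?m = "(1 - 1/2) *\<^sub>R x + (1/2) *\<^sub>R y"
  have "f ?m < (1 - 1/2) * f x + (1/2) * f y"
    by (rule f[unfolded strictly_convex_def, rule_format, OF ne]) auto
  then have "f ?m < f x" using xy by simp
  moreover have "?m \<in> F" by (rule convexD_alt[OF F xy(1,2)]) auto
  ultimately show False using x unfolding is_arg_min_def by blast
qed

lemma argmin_exists:
  fixes f :: "'a::topological_space \<Rightarrow> real"
  assumes "compact F" "F \<noteq> {}" "continuous_on F f"
  shows "\<exists>x. is_arg_min f (\<lambda>x. x \<in> F) x"
  using continuous_attains_inf[OF assms] unfolding is_arg_min_def by (force simp: not_less)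

lemma INF_eq_argmin:
  assumes "is_arg_min f (\<lambda>x. x \<in> F) x"
  shows "(INF x\<in>F. ereal (f x)) = ereal (f x)"
  using assms by (intro antisym INF_lower INF_greatest) (auto simp: is_arg_min_def not_less)

text \<open>
  The limit \<open>x0\<close> minimises \<open>R\<close> over the set \<open>M\<close> of minimisers of \<open>J\<close>. Comparing \<open>x e\<close> with
  \<open>x0\<close> gives \<open>R (x e) \<le> R x0\<close> and \<open>J (x e) < J x0 + e * R x0\<close>. Off a neighbourhood of \<open>x0\<close>, the
  points with \<open>R y \<le> R x0\<close> form a compact set without minimisers of \<open>J\<close>, where \<open>J\<close>
  exceeds its minimum by a fixed \<open>\<delta>\<close>; so \<open>x e\<close> avoids this set once \<open>e * R x0 < \<delta>\<close>.
\<close>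

lemma tikhonov_convergence:
  fixes J R :: "'a::euclidean_space \<Rightarrow> real"
  assumes F: "compact F" "convex F" "F \<noteq> {}"
    and J: "continuous_on F J" "convex_on F J"
    and R: "continuous_on F R" "strictly_convex R" "\<And>x. 0 < R x"
    and x: "\<And>e. e > 0 \<Longrightarrow> is_arg_min (\<lambda>x. J x + e * R x) (\<lambda>x. x \<in> F) (x e)"
  shows "\<exists>x0. is_arg_min J (\<lambda>x. x \<in> F) x0 \<and> (x \<longlongrightarrow> x0) (at_right 0)"
proof -
  obtain m where m: "is_arg_min J (\<lambda>x. x \<in> F) m" using argmin_exists[OF F(1,3) J(1)] by blast
  then have mF: "m \<in> F" and mmin: "\<And>y. y \<in> F \<Longrightarrow> J m \<le> J y"
    by (auto simp: is_arg_min_def not_less)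
  define M where "M = {y \<in> F. J y \<le> J m}"
  have "closedin (top_of_set F) (F \<inter> J -` {..J m})" by (intro continuous_closedin_preimage J) auto
  then have "compact M" using F(1) closedin_compact by (auto simp: M_def vimage_def Int_def)
  have "convex M" unfolding M_def using J(2) by (rule convex_sublevel)
  have "m \<in> M" using mF by (simp add: M_def)
  obtain x0 where x0: "is_arg_min R (\<lambda>x. x \<in> M) x0"
    using argmin_exists[OF \<open>compact M\<close>, of R] \<open>m \<in> M\<close> R(1) continuous_on_subset[of F R M] by (auto simp: M_def)
  then have x0M: "x0 \<in> F" "J x0 = J m" and x0min: "\<And>y. y \<in> M \<Longrightarrow> R x0 \<le> R y"
    using mmin by (auto simp: is_arg_min_def not_less M_def intro: antisym)
  have x0uniq: "y = x0" if "y \<in> M" "R y \<le> R x0" for y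
  proof (rule strictly_convex_argmin_unique[OF R(2) \<open>convex M\<close> _ x0])
    show "is_arg_min R (\<lambda>x. x \<in> M) y"
      using that x0min by (force simp: is_arg_min_def not_less)
  qed
  have "(x \<longlongrightarrow> x0) (at_right 0)"
  proof (rule topological_tendstoI)
    fix U assume U: "open U" "x0 \<in> U"
    define K where "K = {y \<in> F - U. R y \<le> R x0}"
    have "closedin (top_of_set F) (F \<inter> R -` {..R x0})" by (intro continuous_closedin_preimage R) auto
    then have "compact (F \<inter> R -` {..R x0})" using F(1) closedin_compact by blast
    then have "compact ((F \<inter> R -` {..R x0}) \<inter> - U)" by (rule compact_Int_closed) (use U in \<open>auto simp: closed_def\<close>)
    moreover have "(F \<inter> R -` {..R x0}) \<inter> - U = K" by (auto simp: K_def)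
    ultimately have K: "compact K" "K \<subseteq> F" by (auto simp: K_def)
    have "\<exists>\<delta>>0. \<forall>y\<in>K. J m + \<delta> \<le> J y"
    proof (cases "K = {}")
      case False
      obtain k where k: "k \<in> K" "\<forall>y\<in>K. J k \<le> J y"
        using continuous_attains_inf[OF K(1) False continuous_on_subset[OF J(1) K(2)]] by blast
      have "J m < J k"
      proof (rule ccontr)
        assume "\<not> J m < J k"
        then have "k \<in> M" using k K by (auto simp: M_def)
        then have "k = x0" using x0uniq k by (auto simp: K_def)
        with k U show False by (auto simp: K_def)
      qed
      then show ?thesis using k by (intro exI[of _ "J k - J m"]) auto
    qed (auto intro: exI[of _ 1])
    then obtain \<delta> where \<delta>: "\<delta> > 0" "\<And>y. y \<in> K \<Longrightarrow> J m + \<delta> \<le> J y" by blast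
    show "eventually (\<lambda>e. x e \<in> U) (at_right 0)"
      unfolding eventually_at_right_field
    proof (intro exI[of _ "\<delta> / R x0"] conjI allI impI)
      show "0 < \<delta> / R x0" using \<delta> R(3) by simp
      fix e assume e: "0 < e" "e < \<delta> / R x0"
      then have eR: "e * R x0 < \<delta>" using R(3)[of x0] by (simp add: field_simps)
      have xe: "x e \<in> F" "J (x e) + e * R (x e) \<le> J x0 + e * R x0"
        using x[OF e(1)] x0M(1) by (auto simp: is_arg_min_def not_less)
      have "J m \<le> J (x e)" using mmin xe by blast
      then have "e * R (x e) \<le> e * R x0" using xe x0M by linarith
      then have "R (x e) \<le> R x0" using e by simp
      moreover have "J (x e) < J m + \<delta>"
        using xe(2) x0M(2) eR mult_pos_pos[OF e(1) R(3)[of "x e"]] by linarith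
      ultimately show "x e \<in> U" using \<delta>(2)[of "x e"] xe(1) by (force simp: K_def)
    qed
  qed
  moreover have "is_arg_min J (\<lambda>x. x \<in> F) x0"
    using x0M mmin by (force simp: is_arg_min_def not_less)
  ultimately show ?thesis by blast
qed

section \<open>Continuity of the matrix exponential\<close>

lemma matrix_vector_mult_convex_comb:
  fixes A A' :: "real^'n^'m"
  shows "((1 - u) *\<^sub>R A + u *\<^sub>R A') *v x = (1 - u) *\<^sub>R (A *v x) + u *\<^sub>R (A' *v x)"
  by (simp add: matrix_vector_mult_add_rdistrib scaleR_matrix_vector_assoc)

lemma bounded_bilinear_matrix_vector_mult:
  "bounded_bilinear ((*v) :: real^'n^'m \<Rightarrow> real^'n \<Rightarrow> real^'m)"
  unfolding bilinear_conv_bounded_bilinear[symmetric] bilinear_def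
  by (auto intro!: linearI simp: matrix_vector_mult_add_rdistrib matrix_vector_right_distrib
      scaleR_matrix_vector_assoc matrix_vector_mult_scaleR)

lemma bounded_bilinear_matrix_matrix_mult:
  "bounded_bilinear ((**) :: real^'n^'m \<Rightarrow> real^'k^'n \<Rightarrow> real^'k^'m)"
  unfolding bilinear_conv_bounded_bilinear[symmetric] bilinear_def
  by (auto intro!: linearI simp: matrix_matrix_mult_def vec_eq_iff sum.distrib algebra_simps
      sum_distrib_left)

lemmas continuous_on_matrix_vector_mult [continuous_intros] =
  bounded_bilinear.continuous_on[OF bounded_bilinear_matrix_vector_mult]

lemmas continuous_on_matrix_matrix_mult [continuous_intros] =
  bounded_bilinear.continuous_on[OF bounded_bilinear_matrix_matrix_mult]

lemma mat_power_simps [simp]: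
  "mat_power A 0 = mat 1" "mat_power A (Suc k) = A ** mat_power A k"
  by (simp_all add: mat_power_def)

lemma continuous_on_mat_power: "continuous_on UNIV (\<lambda>A :: real^'n^'n. mat_power A k)"
  by (induction k) (auto intro!: continuous_intros)

text \<open>
  The series converges uniformly on balls. The norm on matrices is submultiplicative only up to a
  constant \<open>c\<close>, which enters the majorant through its powers.
\<close>

lemma continuous_on_mat_exp_UNIV: "continuous_on UNIV (mat_exp :: real^'n^'n \<Rightarrow> real^'n^'n)"
proof -
  obtain c where c: "c > 0" "\<And>(A :: real^'n^'n) (B :: real^'n^'n). norm (A ** B) \<le> norm A * norm B * c"
    using bounded_bilinear.pos_bounded[OF bounded_bilinear_matrix_matrix_mult] by blast
  have power: "norm (mat_power A k) \<le> (c * norm A) ^ k * norm (mat 1 :: real^'n^'n)" for A :: "real^'n^'n" and k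
  proof (induction k)
    case (Suc k)
    have "norm (mat_power A (Suc k)) \<le> c * norm A * norm (mat_power A k)"
      using c(2)[of A "mat_power A k"] by (simp add: ac_simps)
    also have "\<dots> \<le> c * norm A * ((c * norm A) ^ k * norm (mat 1 :: real^'n^'n))"
      using Suc c(1) by (intro mult_left_mono) auto
    finally show ?case by (simp add: ac_simps)
  qed simp
  have "continuous_on (ball 0 r) (mat_exp :: real^'n^'n \<Rightarrow> real^'n^'n)" for r
  proof -
    let ?M = "\<lambda>k. inverse (fact k) * (c * r) ^ k * norm (mat 1 :: real^'n^'n)"
    have "uniform_limit (ball 0 r) (\<lambda>n A. \<Sum>k<n. (1 / fact k) *\<^sub>R mat_power A k)
        (\<lambda>A :: real^'n^'n. \<Sum>k. (1 / fact k) *\<^sub>R mat_power A k) sequentially"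
    proof (rule Weierstrass_m_test)
      show "summable ?M" by (intro summable_mult2 summable_exp)
      fix k and A :: "real^'n^'n" assume "A \<in> ball 0 r"
      then have "norm A \<le> r" by simp
      then have "(c * norm A) ^ k \<le> (c * r) ^ k"
        using c(1) by (intro power_mono mult_left_mono) auto
      then have "norm (mat_power A k) \<le> (c * r) ^ k * norm (mat 1 :: real^'n^'n)"
        using power[of A k] by (meson mult_right_mono norm_ge_zero order_trans)
      then show "norm ((1 / fact k) *\<^sub>R mat_power A k) \<le> ?M k"
        by (simp add: field_simps)
    qed
    then show ?thesis unfolding mat_exp_def
      by (rule uniform_limit_theorem[rotated])
        (auto intro!: always_eventually continuous_intros continuous_on_subset[OF continuous_on_mat_power])
  qed
  then have "isCont (mat_exp :: real^'n^'n \<Rightarrow> real^'n^'n) A" for A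
    by (rule continuous_on_interior[of "ball 0 (norm A + 1)"]) simp
  then show ?thesis by (simp add: continuous_at_imp_continuous_on)
qed

lemma continuous_on_mat_exp [continuous_intros]:
  "continuous_on S f \<Longrightarrow> continuous_on S (\<lambda>x. mat_exp (f x))"
  by (rule continuous_on_compose2[OF continuous_on_mat_exp_UNIV]) auto

section \<open>Piecewise constant functions under the integral\<close>

text \<open>
  The condition of \<^const>\<open>PC\<close> for functions with values in any type, so that the two bases can be
  handled as one function with values in a product.
\<close>

definition piecewise_const :: "real \<Rightarrow> nat \<Rightarrow> real \<Rightarrow> (real \<Rightarrow> 'a) \<Rightarrow> bool" where
  "piecewise_const h K T F \<longleftrightarrow>
     (\<forall>k\<in>{1..K}. F constant_on {real (k - 1) * h..<real k * h}) \<and> F constant_on {real K * h..T}"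

lemma piecewise_const_vec:
  assumes "\<And>i. (\<lambda>t. F t $ i) \<in> PC h K T"
  shows "piecewise_const h K T F"
proof -
  have "F constant_on U" if U: "\<And>i. (\<lambda>t. F t $ i) constant_on U" for U
  proof -
    obtain c where "\<And>i t. t \<in> U \<Longrightarrow> F t $ i = c i"
      using U unfolding constant_on_def by metis
    then have "\<forall>t\<in>U. F t = (\<chi> i. c i)" by (simp add: vec_eq_iff)
    then show ?thesis unfolding constant_on_def by blast
  qed
  then show ?thesis using assms unfolding piecewise_const_def PC_def by blast
qed

lemma piecewise_const_Pair:
  "\<lbrakk>piecewise_const h K T F; piecewise_const h K T F'\<rbrakk> \<Longrightarrow> piecewise_const h K T (\<lambda>t. (F t, F' t))"
proof -
  have "(\<lambda>t. (F t, F' t)) constant_on U" if "F constant_on U" "F' constant_on U" for U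
    using that unfolding constant_on_def by (metis (no_types))
  then show "\<lbrakk>piecewise_const h K T F; piecewise_const h K T F'\<rbrakk> \<Longrightarrow> ?thesis"
    unfolding piecewise_const_def by blast
qed

lemma piecewise_const_cover:
  assumes "0 < h" "real K * h \<le> T" "t \<in> {0..T}"
  shows "t \<in> {real K * h..T} \<or> (\<exists>k\<in>{1..K}. t \<in> {real (k - 1) * h..<real k * h})"
proof (cases "real K * h \<le> t")
  case False
  define k where "k = nat \<lfloor>t / h\<rfloor>"
  \<comment> \<open>\<open>k\<close> is the number of full steps before \<open>t\<close>, so \<open>t\<close> lies in piece number \<open>k + 1\<close>.\<close>
  have "0 \<le> t / h" using assms by simp
  then have "real k = of_int \<lfloor>t / h\<rfloor>" by (simp add: k_def)
  then have "real k \<le> t / h" "t / h < real k + 1" by linarith+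
  then have k: "real k * h \<le> t" "t < real (Suc k) * h"
    using assms(1) by (simp_all add: pos_le_divide_eq pos_divide_less_eq algebra_simps)
  have "real k * h < real K * h" using k(1) False by linarith
  then have "k < K" using assms(1) by (simp add: mult_less_cancel_right)
  with k show ?thesis by (intro disjI2 bexI[of _ "Suc k"]) auto
qed (use assms in auto)

lemma piecewise_const_finite:
  assumes "piecewise_const h K T F" "0 < h" "real K * h \<le> T"
  shows "finite (F ` {0..T})"
proof (rule finite_subset)
  have "finite (F ` U)" if U: "F constant_on U" for U
  proof -
    obtain c where "\<And>t. t \<in> U \<Longrightarrow> F t = c" using U unfolding constant_on_def by blast
    then have "F ` U \<subseteq> {c}" by blast
    then show ?thesis by (rule finite_subset) simp
  qed
  then show "finite (F ` {real K * h..T} \<union> (\<Union>k\<in>{1..K}. F ` {real (k - 1) * h..<real k * h}))"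
    using assms(1) unfolding piecewise_const_def by blast
  show "F ` {0..T} \<subseteq> F ` {real K * h..T} \<union> (\<Union>k\<in>{1..K}. F ` {real (k - 1) * h..<real k * h})"
    using piecewise_const_cover[OF assms(2,3)] by blast
qed

text \<open>
  On each piece the integrand agrees with a continuous function except possibly at the right
  endpoint, which is a null set.
\<close>

lemma piecewise_const_integrable:
  fixes g :: "real \<Rightarrow> 'a \<Rightarrow> 'b::banach"
  assumes F: "piecewise_const h K T F" and h: "0 < h" and K: "real K * h \<le> T"
    and g: "\<And>c. continuous_on {0..T} (\<lambda>\<tau>. g \<tau> c)"
  shows "(\<lambda>\<tau>. g \<tau> (F \<tau>)) integrable_on {0..T}"
proof -
  have piece: "(\<lambda>\<tau>. g \<tau> (F \<tau>)) integrable_on {a..b}"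
    if ab: "F constant_on {a..<b}" "0 \<le> a" "b \<le> T" for a b
  proof -
    obtain c where c: "\<And>t. t \<in> {a..<b} \<Longrightarrow> F t = c" using ab(1) unfolding constant_on_def by blast
    have "(\<lambda>\<tau>. g \<tau> c) integrable_on {a..b}"
      by (intro integrable_continuous_real continuous_on_subset[OF g]) (use ab in auto)
    then show ?thesis
      by (rule integrable_spike_finite[of "{b}", rotated 2]) (use c in auto)
  qed
  have "(\<lambda>\<tau>. g \<tau> (F \<tau>)) integrable_on {0..real k * h}" if "k \<le> K" for k
    using that
  proof (induction k)
    case (Suc k)
    have "(\<lambda>\<tau>. g \<tau> (F \<tau>)) integrable_on {real k * h..real (Suc k) * h}"
    proof (rule piece)
      show "F constant_on {real k * h..<real (Suc k) * h}"
        using F Suc.prems unfolding piecewise_const_def by (metis atLeastAtMost_iff diff_Suc_1 le_add1 plus_1_eq_Suc)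
      have "real (Suc k) * h \<le> real K * h" using Suc.prems h by (intro mult_right_mono) auto
      then show "real (Suc k) * h \<le> T" using K by linarith
    qed (use h in auto)
    then show ?case
      by (rule Henstock_Kurzweil_Integration.integrable_combine[rotated 3]) (use h Suc in auto)
  qed (simp add: integrable_on_refl[where a = 0 and 'a = real, simplified])
  moreover have "(\<lambda>\<tau>. g \<tau> (F \<tau>)) integrable_on {real K * h..T}"
    by (rule piece) (use F h in \<open>auto simp: piecewise_const_def constant_on_def\<close>)
  ultimately show ?thesis
    by (rule Henstock_Kurzweil_Integration.integrable_combine[rotated 2]) (use K h in auto)
qed

text \<open>
  Dominated convergence along a sequence \<open>w n \<rightarrow> z\<close>, with the integrands cut off at the upper
  limit \<open>u (w n)\<close>. The cut-off integrands may fail to converge at the single point \<open>u z\<close>, so this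
  point is removed from the domain of integration.
\<close>

lemma continuous_on_integral_upper_limit_param:
  fixes f :: "'z::metric_space \<Rightarrow> real \<Rightarrow> 'c::euclidean_space"
  assumes bdd: "\<And>z \<tau>. \<lbrakk>z \<in> Z; \<tau> \<in> {0..T}\<rbrakk> \<Longrightarrow> norm (f z \<tau>) \<le> M"
    and int: "\<And>z. z \<in> Z \<Longrightarrow> f z integrable_on {0..T}"
    and cont: "\<And>\<tau>. \<tau> \<in> {0..T} \<Longrightarrow> continuous_on Z (\<lambda>z. f z \<tau>)"
    and u: "continuous_on Z u" "u ` Z \<subseteq> {0..T}"
  shows "continuous_on Z (\<lambda>z. integral {0..u z} (f z))"
proof (rule continuous_on_sequentiallyI)
  fix w z assume w: "\<forall>n. w n \<in> Z" and z: "z \<in> Z" and lim: "w \<longlonglongrightarrow> z"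
  let ?r = "\<lambda>y \<tau>. if \<tau> \<in> {0..u y} then f y \<tau> else 0"
  let ?S = "{0..T} - {u z}"
  have r: "?r y integrable_on ?S" "integral ?S (?r y) = integral {0..u y} (f y)" if "y \<in> Z" for y
  proof -
    have y: "{0..u y} \<inter> {0..T} = {0..u y}" "{0..u y} \<subseteq> {0..T}" using u(2) that by auto
    have "f y integrable_on {0..u y}" using int[OF that] y(2) by (rule integrable_on_subinterval)
    then have "?r y integrable_on {0..T}"
      using y by (simp only: integrable_restrict_Int)
    then show "?r y integrable_on ?S"
      by (rule integrable_spike_set) (auto intro: negligible_subset[of "{u z}"])
    have "integral ?S (?r y) = integral {0..T} (?r y)"
      by (rule integral_spike_set) (auto intro: negligible_subset[of "{u z}"])
    then show "integral ?S (?r y) = integral {0..u y} (f y)"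
      using y(1) by (simp only: integral_restrict_Int)
  qed
  have ulim: "(\<lambda>n. u (w n)) \<longlonglongrightarrow> u z"
    using u(1) w z lim unfolding continuous_on_sequentially by (auto simp: o_def)
  have "(\<lambda>n. integral ?S (?r (w n))) \<longlonglongrightarrow> integral ?S (?r z)"
  proof (rule dominated_convergence(2))
    show "?r (w n) integrable_on ?S" for n using r w by blast
    have "(\<lambda>_. M) integrable_on {0..T}" by (rule integrable_const_ivl)
    then show "(\<lambda>_. M) integrable_on ?S"
      by (rule integrable_spike_set) (auto intro: negligible_subset[of "{u z}"])
    show "norm (?r (w n) \<tau>) \<le> M" if "\<tau> \<in> ?S" for n \<tau>
      using bdd[of "w n" \<tau>] order_trans[OF norm_ge_zero bdd[of "w n" \<tau>]] w that by auto
    show "(\<lambda>n. ?r (w n) \<tau>) \<longlonglongrightarrow> ?r z \<tau>" if \<tau>: "\<tau> \<in> ?S" for \<tau>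
    proof (cases "\<tau> < u z")
      case True
      have "(\<lambda>n. f (w n) \<tau>) \<longlonglongrightarrow> f z \<tau>"
        using cont[of \<tau>] \<tau> w z lim unfolding continuous_on_sequentially by (auto simp: o_def)
      moreover have "eventually (\<lambda>n. \<tau> < u (w n)) sequentially"
        using ulim True by (rule order_tendstoD)
      then have "eventually (\<lambda>n. f (w n) \<tau> = ?r (w n) \<tau>) sequentially"
        by eventually_elim (use \<tau> in auto)
      ultimately have "(\<lambda>n. ?r (w n) \<tau>) \<longlonglongrightarrow> f z \<tau>" by (rule Lim_transform_eventually)
      with True \<tau> show ?thesis by simp
    next
      case False
      then have "eventually (\<lambda>n. u (w n) < \<tau>) sequentially"
        using ulim \<tau> by (intro order_tendstoD) auto
      then have "eventually (\<lambda>n. ?r (w n) \<tau> = ?r z \<tau>) sequentially"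
        by eventually_elim (use \<tau> False in auto)
      then show ?thesis by (rule tendsto_eventually)
    qed
  qed
  then show "(\<lambda>n. integral {0..u (w n)} (f (w n))) \<longlonglongrightarrow> integral {0..u z} (f z)"
    using r z w by simp
qed

section \<open>Compactness of sets of coefficient matrices\<close>

lemma compact_vec_box:
  fixes U :: "'a::euclidean_space set"
  assumes "compact U"
  shows "compact {v :: 'a^'n. \<forall>i. v $ i \<in> U}"
proof -
  obtain b where b: "\<And>x. x \<in> U \<Longrightarrow> norm x \<le> b"
    using compact_imp_bounded[OF assms] unfolding bounded_iff by blast
  have "norm v \<le> (\<Sum>i\<in>(UNIV :: 'n set). b)" if "\<forall>i. v $ i \<in> U" for v :: "'a^'n"
  proof -
    have "norm v \<le> (\<Sum>i\<in>UNIV. norm (v $ i))" unfolding norm_vec_def by (rule L2_set_le_sum) simp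
    also have "\<dots> \<le> (\<Sum>i\<in>(UNIV :: 'n set). b)" using b that by (intro sum_mono) auto
    finally show ?thesis .
  qed
  then have "bounded {v :: 'a^'n. \<forall>i. v $ i \<in> U}" unfolding bounded_iff by blast
  moreover have "closed {v :: 'a^'n. \<forall>i. v $ i \<in> U}"
    using closed_vector_box[of "\<lambda>_. U"] compact_imp_closed[OF assms] by simp
  ultimately show ?thesis by (simp add: compact_eq_bounded_closed)
qed

text \<open>
  The vectors \<open>w\<close> for which \<open>\<Theta> *v w\<close> is bounded uniformly over the set form a subspace; since it
  contains \<open>W\<close>, it contains the unit vectors, which recover the entries of \<open>\<Theta>\<close>.
\<close>

lemma bounded_rows_against_spanning:
  fixes W :: "(real^'n) set"
  assumes W: "span W = UNIV"
  shows "bounded {\<Theta> :: real^'n^'m. \<forall>w\<in>W. \<forall>i. (\<Theta> *v w) $ i \<in> {- b $ i..b $ i}}" (is "bounded ?A")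
proof -
  have comp: "\<exists>c. \<forall>\<Theta>\<in>?A. \<bar>(\<Theta> *v w) $ i\<bar> \<le> c" if "w \<in> span W" for w i
    using that
  proof (induction rule: span_induct_alt)
    case (step r x y)
    then obtain c where c: "\<forall>\<Theta>\<in>?A. \<bar>(\<Theta> *v y) $ i\<bar> \<le> c" by blast
    have "\<bar>(\<Theta> *v (r *\<^sub>R x + y)) $ i\<bar> \<le> \<bar>r\<bar> * b $ i + c" if \<Theta>: "\<Theta> \<in> ?A" for \<Theta>
    proof -
      have "\<bar>(\<Theta> *v x) $ i\<bar> \<le> b $ i" using \<Theta> step(1) by (auto simp: abs_le_iff minus_le_iff)
      then have "\<bar>r * (\<Theta> *v x) $ i\<bar> \<le> \<bar>r\<bar> * b $ i" by (simp add: abs_mult mult_left_mono)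
      moreover have "\<bar>(\<Theta> *v y) $ i\<bar> \<le> c" using c \<Theta> by blast
      moreover have "(\<Theta> *v (r *\<^sub>R x + y)) $ i = r * (\<Theta> *v x) $ i + (\<Theta> *v y) $ i"
        by (simp add: matrix_vector_right_distrib matrix_vector_mult_scaleR)
      ultimately show ?thesis by linarith
    qed
    then show ?case by blast
  qed (auto intro: exI[of _ 0])
  have "(\<Theta> *v axis j 1) $ i = \<Theta> $ i $ j" for \<Theta> :: "real^'n^'m" and i j
    by (simp add: matrix_vector_mult_basis column_def)
  then have "\<exists>c. \<forall>\<Theta>\<in>?A. \<bar>\<Theta> $ i $ j\<bar> \<le> c" for i j
    using comp[of "axis j 1" i] unfolding W by simp
  then have "\<exists>c. \<forall>i j. \<forall>\<Theta>\<in>?A. \<bar>\<Theta> $ i $ j\<bar> \<le> c i j"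
    by (intro choice allI)
  then obtain c where c: "\<And>i j \<Theta>. \<Theta> \<in> ?A \<Longrightarrow> \<bar>\<Theta> $ i $ j\<bar> \<le> c i j" by blast
  have "norm \<Theta> \<le> (\<Sum>i\<in>UNIV. \<Sum>j\<in>UNIV. c i j)" if "\<Theta> \<in> ?A" for \<Theta>
  proof -
    have "norm \<Theta> \<le> (\<Sum>i\<in>UNIV. norm (\<Theta> $ i))" unfolding norm_vec_def by (rule L2_set_le_sum) simp
    also have "\<dots> \<le> (\<Sum>i\<in>UNIV. \<Sum>j\<in>UNIV. \<bar>\<Theta> $ i $ j\<bar>)" by (intro sum_mono norm_le_l1_cart)
    also have "\<dots> \<le> (\<Sum>i\<in>UNIV. \<Sum>j\<in>UNIV. c i j)" using c[OF that] by (intro sum_mono)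
    finally show ?thesis .
  qed
  then show ?thesis unfolding bounded_iff by blast
qed

text \<open>
  Linear independence of the component functions means that no nonzero vector is orthogonal to
  all values \<open>F t\<close>; these values therefore span the space, which gives boundedness.
\<close>

lemma coefficient_box:
  fixes F :: "real \<Rightarrow> real^'n" and b :: "real^'m"
  assumes F: "PC_basis h K T F"
  shows "compact {\<Theta> :: real^'n^'m. \<forall>t\<in>{0..T}. \<forall>i. (\<Theta> *v F t) $ i \<in> {- b $ i..b $ i}}" (is "compact ?A")
    and "convex {\<Theta> :: real^'n^'m. \<forall>t\<in>{0..T}. \<forall>i. (\<Theta> *v F t) $ i \<in> {- b $ i..b $ i}}"
proof -
  have "span (F ` {0..T}) = UNIV"
  proof (rule ccontr)
    assume "span (F ` {0..T}) \<noteq> UNIV"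
    then obtain a where a: "a \<noteq> 0" "\<forall>x\<in>span (F ` {0..T}). a \<bullet> x = 0"
      using span_not_UNIV_orthogonal by blast
    then have "a \<bullet> F t = 0" if "t \<in> {0..T}" for t using that by (simp add: span_base)
    then have "\<forall>t\<in>{0..T}. (\<Sum>i\<in>UNIV. a $ i * F t $ i) = 0" by (simp add: inner_vec_def)
    then have "\<forall>i. a $ i = 0" using F[unfolded PC_basis_def, THEN conjunct2, THEN conjunct1] by (elim allE) (erule mp)
    with a show False by (simp add: vec_eq_iff)
  qed
  from bounded_rows_against_spanning[OF this, of b] have "bounded ?A" by simp
  have lin: "linear (\<lambda>\<Theta> :: real^'n^'m. (\<Theta> *v F t) $ i)" for t i
    by (auto intro!: linearI simp: matrix_vector_mult_add_rdistrib scaleR_matrix_vector_assoc[symmetric])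
  have A: "?A = (\<Inter>t\<in>{0..T}. \<Inter>i. (\<lambda>\<Theta>. (\<Theta> *v F t) $ i) -` {- b $ i..b $ i})" by auto
  have "closed ?A" unfolding A
    by (intro closed_INT ballI closed_vimage closed_atLeastAtMost
        linear_continuous_on linear_conv_bounded_linear[THEN iffD1] lin)
  with \<open>bounded ?A\<close> show "compact ?A" by (simp add: compact_eq_bounded_closed)
  show "convex ?A" unfolding A
    by (intro convex_INT convex_linear_vimage lin convex_real_interval)
qed

section \<open>Trajectories of a well-posed problem\<close>

locale well_posed_problem =
  fixes S :: "('d::finite, 'm::finite, 'v::finite, 'N::finite, 'M::finite) control_problem"
    and xbar :: "real^'d"
  assumes well_posed: "well_posed S"
begin

abbreviation "T \<equiv> horizon S"

abbreviation scenarios :: "(real \<times> (real^'M^'d) \<times> (real^'v)) set" where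
  "scenarios \<equiv> {0..T} \<times> adm_\<beta> S \<times> params S"

lemmas wp = well_posed[unfolded well_posed_def]

lemma T_pos: "0 < T" and contA: "continuous_on (params S) (mat_A S)"
  and contB: "continuous_on (params S) (mat_B S)"
  using wp by auto

lemma compact_adm_\<Theta>: "compact (adm_\<Theta> S)" and convex_adm_\<Theta>: "convex (adm_\<Theta> S)"
proof -
  have "adm_\<Theta> S = {\<Theta>. \<forall>t\<in>{0..T}. \<forall>i. (\<Theta> *v \<Psi> S t) $ i \<in> {- ubar S $ i..ubar S $ i}}"
    by (simp add: adm_\<Theta>_def control_set_def)
  moreover have "PC_basis (mesh S) (num_steps S) T (\<Psi> S)" using wp by blast
  ultimately show "compact (adm_\<Theta> S)" "convex (adm_\<Theta> S)"
    using coefficient_box[of "mesh S" "num_steps S" T "\<Psi> S" "ubar S"] by simp_all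
qed

lemma compact_adm_\<beta>: "compact (adm_\<beta> S)"
proof -
  have "adm_\<beta> S = {\<beta>. \<forall>t\<in>{0..T}. \<forall>i. (\<beta> *v \<Phi> S t) $ i \<in> {- wbar S $ i..wbar S $ i}}"
    by (simp add: adm_\<beta>_def disturbance_set_def)
  moreover have "PC_basis (mesh S) (num_steps S) T (\<Phi> S)" using wp by blast
  ultimately show ?thesis
    using coefficient_box(1)[of "mesh S" "num_steps S" T "\<Phi> S" "wbar S"] by simp
qed

lemma zero_in_adm_\<beta>: "0 \<in> adm_\<beta> S"
proof -
  have "\<And>j. 0 \<le> wbar S $ j" using wp by (meson less_imp_le)
  then show ?thesis by (simp add: adm_\<beta>_def disturbance_set_def)
qed

lemma scenarios_nonempty: "scenarios \<noteq> {}"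
  using wp zero_in_adm_\<beta> T_pos by auto

lemma piecewise_const_basis:
  "piecewise_const (mesh S) (num_steps S) T (\<lambda>t. (\<Psi> S t, \<Phi> S t))"
  using wp unfolding PC_basis_def
  by (intro piecewise_const_Pair piecewise_const_vec) blast+

lemma integrable_basis:
  fixes g :: "real \<Rightarrow> (real^'N) \<times> (real^'M) \<Rightarrow> 'c::banach"
  assumes "\<And>c. continuous_on {0..T} (\<lambda>\<tau>. g \<tau> c)"
  shows "(\<lambda>\<tau>. g \<tau> (\<Psi> S \<tau>, \<Phi> S \<tau>)) integrable_on {0..T}"
  by (rule piecewise_const_integrable[OF piecewise_const_basis _ _ assms]) (use wp in auto)

text \<open>
  The integrand of the variation-of-constants formula as a function of a basis value
  \<open>(\<psi>, \<phi>)\<close> instead of time. For a fixed basis value it is continuous in everything else, which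
  separates the continuous dependence from the jumps of the bases.
\<close>

definition response :: "real \<times> (real^'N^'m) \<times> (real^'M^'d) \<times> (real^'v) \<Rightarrow> real \<Rightarrow>
    (real^'N) \<times> (real^'M) \<Rightarrow> real^'d" where
  "response = (\<lambda>(t, \<Theta>, \<beta>, p) \<tau> (\<psi>, \<phi>).
     mat_exp ((t - \<tau>) *\<^sub>R mat_A S p) *v (mat_B S p *v (\<Theta> *v \<psi>) + \<beta> *v \<phi>))"

lemma trajectory_response:
  "trajectory S t xbar \<Theta> \<beta> p =
     mat_exp (t *\<^sub>R mat_A S p) *v xbar +
     integral {0..t} (\<lambda>\<tau>. response (t, \<Theta>, \<beta>, p) \<tau> (\<Psi> S \<tau>, \<Phi> S \<tau>))"
  by (simp add: trajectory_def response_def)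

lemma response_integrable:
  "(\<lambda>\<tau>. response z \<tau> (\<Psi> S \<tau>, \<Phi> S \<tau>)) integrable_on {0..T}"
  by (rule integrable_basis) (auto simp: response_def split_beta intro!: continuous_intros)

lemma trajectory_convex_comb:
  assumes "t \<in> {0..T}"
  shows "trajectory S t xbar ((1 - u) *\<^sub>R \<Theta> + u *\<^sub>R \<Theta>') \<beta> p =
    (1 - u) *\<^sub>R trajectory S t xbar \<Theta> \<beta> p + u *\<^sub>R trajectory S t xbar \<Theta>' \<beta> p"
proof -
  let ?f = "\<lambda>\<Theta> \<tau>. response (t, \<Theta>, \<beta>, p) \<tau> (\<Psi> S \<tau>, \<Phi> S \<tau>)"
  have int: "?f \<Theta> integrable_on {0..t}" for \<Theta>
    using response_integrable by (rule integrable_on_subinterval) (use assms in auto)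
  have "?f ((1 - u) *\<^sub>R \<Theta> + u *\<^sub>R \<Theta>') \<tau> = (1 - u) *\<^sub>R ?f \<Theta> \<tau> + u *\<^sub>R ?f \<Theta>' \<tau>" for \<tau>
  proof -
    define E where "E = mat_exp ((t - \<tau>) *\<^sub>R mat_A S p)"
    have f: "?f \<Theta> \<tau> = E *v (mat_B S p *v (\<Theta> *v \<Psi> S \<tau>)) + E *v (\<beta> *v \<Phi> S \<tau>)" for \<Theta>
      by (simp add: response_def E_def matrix_vector_right_distrib)
    show ?thesis
      unfolding f matrix_vector_mult_convex_comb matrix_vector_right_distrib matrix_vector_mult_scaleR
      by (simp add: algebra_simps)
  qed
  then have "integral {0..t} (?f ((1 - u) *\<^sub>R \<Theta> + u *\<^sub>R \<Theta>')) =
      (1 - u) *\<^sub>R integral {0..t} (?f \<Theta>) + u *\<^sub>R integral {0..t} (?f \<Theta>')"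
    by (simp add: integral_add integrable_cmul int)
  then show ?thesis unfolding trajectory_response by (simp add: algebra_simps)
qed

text \<open>
  The bases take finitely many values, so the integrand ranges over the continuous image of a
  compact set; the resulting bound is the dominating constant.
\<close>

lemma continuous_on_trajectory:
  "continuous_on ({0..T} \<times> adm_\<Theta> S \<times> adm_\<beta> S \<times> params S) (\<lambda>(t, \<Theta>, \<beta>, p). trajectory S t xbar \<Theta> \<beta> p)"
    (is "continuous_on ?Z _")
proof -
  let ?W = "(\<lambda>t. (\<Psi> S t, \<Phi> S t)) ` {0..T}"
  have W: "compact ?W"
    using piecewise_const_finite[OF piecewise_const_basis] wp by (intro finite_imp_compact) auto
  have Z: "compact ?Z" using wp compact_adm_\<Theta> compact_adm_\<beta> by (intro compact_Times) auto
  have cont: "continuous_on (?Z \<times> UNIV \<times> UNIV) (\<lambda>(z, \<tau>, c). response z \<tau> c)"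
    unfolding response_def split_beta
    by (intro continuous_intros continuous_on_compose2[OF contA] continuous_on_compose2[OF contB]) auto
  let ?Y = "(\<lambda>(z, \<tau>, c). response z \<tau> c) ` (?Z \<times> {0..T} \<times> ?W)"
  have "compact ?Y"
    by (intro compact_continuous_image compact_Times Z W continuous_on_subset[OF cont]) auto
  then have "bounded ?Y" by (rule compact_imp_bounded)
  then obtain M where M: "\<forall>x\<in>?Y. norm x \<le> M" unfolding bounded_iff by (rule exE)
  have "continuous_on ?Z (\<lambda>z. integral {0..fst z} (\<lambda>\<tau>. response z \<tau> (\<Psi> S \<tau>, \<Phi> S \<tau>)))"
  proof (rule continuous_on_integral_upper_limit_param)
    show "norm (response z \<tau> (\<Psi> S \<tau>, \<Phi> S \<tau>)) \<le> M" if "z \<in> ?Z" "\<tau> \<in> {0..T}" for z \<tau>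
    proof -
      have "(z, \<tau>, \<Psi> S \<tau>, \<Phi> S \<tau>) \<in> ?Z \<times> {0..T} \<times> ?W" using that by (intro SigmaI imageI)
      then have "response z \<tau> (\<Psi> S \<tau>, \<Phi> S \<tau>) \<in> ?Y" by (rule rev_image_eqI) simp
      with M show ?thesis by (rule bspec)
    qed
    have "continuous_on ?Z (\<lambda>z. (\<lambda>(z, \<tau>, c). response z \<tau> c) (z, \<tau>, (\<Psi> S \<tau>, \<Phi> S \<tau>)))" for \<tau>
      by (rule continuous_on_compose2[OF cont]) (auto intro!: continuous_intros)
    then show "continuous_on ?Z (\<lambda>z. response z \<tau> (\<Psi> S \<tau>, \<Phi> S \<tau>))" for \<tau> by simp
  qed (auto intro: response_integrable continuous_intros)
  moreover have "continuous_on ?Z (\<lambda>z. mat_exp (fst z *\<^sub>R mat_A S (snd (snd (snd z)))) *v xbar)"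
    by (intro continuous_intros continuous_on_compose2[OF contA]) auto
  ultimately have "continuous_on ?Z (\<lambda>z. mat_exp (fst z *\<^sub>R mat_A S (snd (snd (snd z)))) *v xbar +
      integral {0..fst z} (\<lambda>\<tau>. response z \<tau> (\<Psi> S \<tau>, \<Phi> S \<tau>)))"
    by (intro continuous_on_add)
  then show ?thesis
    by (rule continuous_on_eq) (auto simp: trajectory_response)
qed

section \<open>The constraints as a family of convex sets\<close>

text \<open>
  Both state constraints of a scenario say that this one pair, affine in \<open>\<Theta>\<close>, lies in a
  convex set.
\<close>

definition endpoints :: "real^'N^'m \<Rightarrow> real \<times> (real^'M^'d) \<times> (real^'v) \<Rightarrow> (real^'d) \<times> (real^'d)" where
  "endpoints \<Theta> = (\<lambda>(t, \<beta>, p). (trajectory S t xbar \<Theta> \<beta> p, trajectory S T xbar \<Theta> \<beta> p))"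

abbreviation "target \<equiv> state_set S \<times> final_set S"

lemma target: "closed target" "convex target"
  using wp by (auto intro: closed_Times compact_imp_closed convex_Times)

lemma continuous_on_endpoints:
  "continuous_on (adm_\<Theta> S \<times> scenarios) (\<lambda>(\<Theta>, z). endpoints \<Theta> z)"
proof -
  have "continuous_on (adm_\<Theta> S \<times> scenarios)
      (\<lambda>x. (\<lambda>(t, \<Theta>, \<beta>, p). trajectory S t xbar \<Theta> \<beta> p) (fst (snd x), fst x, fst (snd (snd x)), snd (snd (snd x))))"
    "continuous_on (adm_\<Theta> S \<times> scenarios)
      (\<lambda>x. (\<lambda>(t, \<Theta>, \<beta>, p). trajectory S t xbar \<Theta> \<beta> p) (T, fst x, fst (snd (snd x)), snd (snd (snd x))))"
    by (rule continuous_on_compose2[OF continuous_on_trajectory];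
        use T_pos in \<open>auto intro!: continuous_intros\<close>)+
  then show ?thesis
    unfolding endpoints_def split_beta by (auto intro!: continuous_intros)
qed

lemma endpoints_convex_comb:
  assumes "z \<in> scenarios"
  shows "endpoints ((1 - u) *\<^sub>R \<Theta> + u *\<^sub>R \<Theta>') z = (1 - u) *\<^sub>R endpoints \<Theta> z + u *\<^sub>R endpoints \<Theta>' z"
  using assms T_pos by (cases z) (simp add: endpoints_def trajectory_convex_comb)

definition feasible_for :: "real \<times> (real^'M^'d) \<times> (real^'v) \<Rightarrow> (real^'N^'m) set" where
  "feasible_for z = {\<Theta> \<in> adm_\<Theta> S. endpoints \<Theta> z \<in> target}"

text \<open>
  The control constraint at a single time is already part of admissibility. This matters for
  continuity, since \<open>\<Psi>\<close> may jump in \<open>t\<close>.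
\<close>

lemma constraints_at_iff:
  "\<lbrakk>\<Theta> \<in> adm_\<Theta> S; t \<in> {0..T}\<rbrakk> \<Longrightarrow>
    constraints_at S xbar \<Theta> t \<beta> p \<longleftrightarrow> endpoints \<Theta> (t, \<beta>, p) \<in> target"
  by (auto simp: constraints_at_def endpoints_def adm_\<Theta>_def)

lemma robust_feasible_eq: "robust_feasible S xbar = (\<Inter>z\<in>scenarios. feasible_for z)"
proof -
  obtain t \<beta> p where z: "t \<in> {0..T}" "\<beta> \<in> adm_\<beta> S" "p \<in> params S" using scenarios_nonempty by auto
  show ?thesis
  proof (intro equalityI subsetI)
    fix \<Theta> assume \<Theta>: "\<Theta> \<in> (\<Inter>z\<in>scenarios. feasible_for z)"
    then have "\<Theta> \<in> feasible_for (t, \<beta>, p)" using z by blast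
    then have "\<Theta> \<in> adm_\<Theta> S" by (simp add: feasible_for_def)
    with \<Theta> show "\<Theta> \<in> robust_feasible S xbar"
      by (auto simp: robust_feasible_def constraints_at_iff feasible_for_def)
  qed (auto simp: robust_feasible_def constraints_at_iff feasible_for_def)
qed

lemma relaxed_feasible_eq:
  assumes "(ts, bs, ps) \<in> index_set S"
  shows "relaxed_feasible S xbar ts bs ps = {\<Theta> \<in> adm_\<Theta> S. \<forall>i. endpoints \<Theta> (ts $ i, bs $ i, ps $ i) \<in> target}"
  using assms by (auto simp: relaxed_feasible_def constraints_at_iff index_set_def)

lemma feasible_for_closed_convex:
  assumes z: "z \<in> scenarios"
  shows "closed (feasible_for z)" "convex (feasible_for z)"
proof -
  have "continuous_on (adm_\<Theta> S) (\<lambda>\<Theta>. (\<lambda>(\<Theta>, z). endpoints \<Theta> z) (\<Theta>, z))"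
    by (rule continuous_on_compose2[OF continuous_on_endpoints]) (use z in \<open>auto intro!: continuous_intros\<close>)
  then have "closed (adm_\<Theta> S \<inter> (\<lambda>\<Theta>. endpoints \<Theta> z) -` target)"
    by (intro continuous_closed_preimage target compact_imp_closed compact_adm_\<Theta>) simp
  then show "closed (feasible_for z)" by (simp add: feasible_for_def vimage_def Int_def)
  show "convex (feasible_for z)"
    unfolding convex_alt feasible_for_def
    using convexD_alt[OF convex_adm_\<Theta>] convexD_alt[OF target(2)] z
    by (auto simp: endpoints_convex_comb simp del: mem_Times_iff)
qed

lemma robust_feasible_compact_convex:
  "compact (robust_feasible S xbar)" "convex (robust_feasible S xbar)"
proof -
  have "closed (robust_feasible S xbar)" unfolding robust_feasible_eq
    by (intro closed_INT ballI feasible_for_closed_convex)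
  moreover have "robust_feasible S xbar = adm_\<Theta> S \<inter> robust_feasible S xbar"
    by (auto simp: robust_feasible_def)
  ultimately show "compact (robust_feasible S xbar)"
    using compact_adm_\<Theta> compact_Int_closed by metis
  show "convex (robust_feasible S xbar)" unfolding robust_feasible_eq
    by (intro convex_INT feasible_for_closed_convex)
qed

lemma relaxed_feasible_compact_convex:
  assumes "(ts, bs, ps) \<in> index_set S"
  shows "compact (relaxed_feasible S xbar ts bs ps)" "convex (relaxed_feasible S xbar ts bs ps)"
proof -
  have eq: "relaxed_feasible S xbar ts bs ps = adm_\<Theta> S \<inter> (\<Inter>i. feasible_for (ts $ i, bs $ i, ps $ i))"
    using relaxed_feasible_eq[OF assms] by (auto simp: feasible_for_def)
  have i: "(ts $ i, bs $ i, ps $ i) \<in> scenarios" for i using assms by (simp add: index_set_def)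
  show "compact (relaxed_feasible S xbar ts bs ps)" unfolding eq
    by (intro compact_Int_closed compact_adm_\<Theta> closed_INT ballI feasible_for_closed_convex i)
  show "convex (relaxed_feasible S xbar ts bs ps)" unfolding eq
    by (intro convex_Int convex_adm_\<Theta> convex_INT feasible_for_closed_convex i)
qed

lemma robust_subset_relaxed:
  "(ts, bs, ps) \<in> index_set S \<Longrightarrow> robust_feasible S xbar \<subseteq> relaxed_feasible S xbar ts bs ps"
  by (auto simp: robust_feasible_def relaxed_feasible_def index_set_def)

section \<open>Convexity of the cost\<close>

lemma l1_norm_convex:
  assumes "0 \<le> u" "u \<le> 1"
  shows "l1_norm ((1 - u) *\<^sub>R a + u *\<^sub>R b) \<le> (1 - u) * l1_norm a + u * l1_norm b"
proof -
  have "\<bar>(1 - u) * a $ i + u * b $ i\<bar> \<le> (1 - u) * \<bar>a $ i\<bar> + u * \<bar>b $ i\<bar>" for i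
    using abs_triangle_ineq[of "(1 - u) * a $ i" "u * b $ i"] assms by (simp add: abs_mult)
  then show ?thesis
    unfolding l1_norm_def sum_distrib_left sum.distrib[symmetric] by (intro sum_mono) simp
qed

lemma cost_convex: "convex_on UNIV (cost S)"
proof (rule convex_onI)
  fix u :: real and \<Theta> \<Theta>' :: "real^'N^'m" assume u: "0 < u" "u < 1"
  let ?l = "\<lambda>\<Theta> t. l1_norm (\<Theta> *v \<Psi> S t)"
  have int: "?l \<Theta> integrable_on {0..T}" for \<Theta>
    using integrable_basis[of "\<lambda>_ c. l1_norm (\<Theta> *v fst c)"] by simp
  have "cost S ((1 - u) *\<^sub>R \<Theta> + u *\<^sub>R \<Theta>') \<le> integral {0..T} (\<lambda>t. (1 - u) * ?l \<Theta> t + u * ?l \<Theta>' t)"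
    unfolding cost_def matrix_vector_mult_convex_comb
    by (intro integral_le integrable_add integrable_on_mult_right int l1_norm_convex
        int[of "(1 - u) *\<^sub>R \<Theta> + u *\<^sub>R \<Theta>'", unfolded matrix_vector_mult_convex_comb]) (use u in auto)
  also have "\<dots> = (1 - u) * cost S \<Theta> + u * cost S \<Theta>'"
    unfolding cost_def by (simp add: integral_add integrable_on_mult_right int)
  finally show "cost S ((1 - u) *\<^sub>R \<Theta> + u *\<^sub>R \<Theta>') \<le> (1 - u) * cost S \<Theta> + u * cost S \<Theta>'" .
qed simp

lemma continuous_on_cost: "continuous_on U (cost S)"
  using convex_on_continuous[OF open_UNIV cost_convex] by (rule continuous_on_subset) simp

lemma continuous_on_reg_cost: "continuous_on U (reg_cost S \<epsilon>)"
proof -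
  have "continuous_on U (regularizer S)" using wp continuous_on_subset by blast
  then show ?thesis unfolding reg_cost_def[abs_def] by (intro continuous_intros continuous_on_cost)
qed

lemma strictly_convex_reg_cost:
  assumes "0 < \<epsilon>"
  shows "strictly_convex (reg_cost S \<epsilon>)"
  unfolding strictly_convex_def
proof (intro allI impI)
  fix \<Theta> \<Theta>' :: "real^'N^'m" and u :: real assume *: "\<Theta> \<noteq> \<Theta>'" "0 < u" "u < 1"
  let ?\<Theta> = "(1 - u) *\<^sub>R \<Theta> + u *\<^sub>R \<Theta>'"
  have "strictly_convex (regularizer S)" using wp by blast
  then have "regularizer S ?\<Theta> < (1 - u) * regularizer S \<Theta> + u * regularizer S \<Theta>'"
    using * unfolding strictly_convex_def by blast
  then have "\<epsilon> * regularizer S ?\<Theta> < \<epsilon> * ((1 - u) * regularizer S \<Theta> + u * regularizer S \<Theta>')"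
    using assms by simp
  moreover have "cost S ?\<Theta> \<le> (1 - u) * cost S \<Theta> + u * cost S \<Theta>'"
    using convex_onD[OF cost_convex] * by simp
  ultimately show "reg_cost S \<epsilon> ?\<Theta> < (1 - u) * reg_cost S \<epsilon> \<Theta> + u * reg_cost S \<epsilon> \<Theta>'"
    unfolding reg_cost_def by (simp add: algebra_simps)
qed

lemma convex_on_reg_cost:
  assumes "0 < \<epsilon>" "convex U"
  shows "convex_on U (reg_cost S \<epsilon>)"
proof (rule convex_onI[OF _ assms(2)])
  fix u x y assume "0 < u" "u < (1::real)"
  then show "reg_cost S \<epsilon> ((1 - u) *\<^sub>R x + u *\<^sub>R y) \<le> (1 - u) * reg_cost S \<epsilon> x + u * reg_cost S \<epsilon> y"
    using strictly_convex_reg_cost[OF assms(1)] unfolding strictly_convex_def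
    by (cases "x = y") (auto simp: scaleR_left_distrib[symmetric] algebra_simps intro: less_imp_le)
qed

section \<open>The relaxed programs under strict feasibility\<close>

end

locale strictly_feasible_problem = well_posed_problem S xbar
  for S :: "('d::finite, 'm::finite, 'v::finite, 'N::finite, 'M::finite) control_problem"
    and xbar :: "real^'d" +
  assumes strictly_feasible: "strictly_feasible S xbar"
begin

text \<open>
  Because \<open>\<Theta> *v \<Psi> S t\<close> depends on neither the disturbance nor the parameter, the strict
  constraints at zero disturbance and one parameter make \<open>\<Theta>\<close> admissible.
\<close>

lemma slater_point:
  obtains \<Theta> where "\<Theta> \<in> adm_\<Theta> S" "\<And>z. z \<in> scenarios \<Longrightarrow> endpoints \<Theta> z \<in> interior target"
proof -
  obtain \<Theta> Q where Q: "Q \<subseteq> interior (state_set S) \<times> interior (control_set S)"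
    and \<Theta>: "\<And>\<beta> p t. \<lbrakk>\<beta> \<in> adm_\<beta> S; p \<in> params S; t \<in> {0..T}\<rbrakk> \<Longrightarrow>
      (trajectory S t xbar \<Theta> \<beta> p, \<Theta> *v \<Psi> S t) \<in> Q \<and>
      trajectory S T xbar \<Theta> \<beta> p \<in> interior (final_set S)"
    using strictly_feasible unfolding strictly_feasible_def by metis
  obtain p where p: "p \<in> params S" using wp by blast
  show ?thesis
  proof (rule that)
    show "\<Theta> \<in> adm_\<Theta> S"
      unfolding adm_\<Theta>_def
    proof (intro CollectI ballI)
      fix t assume "t \<in> {0..T}"
      then have "(trajectory S t xbar \<Theta> 0 p, \<Theta> *v \<Psi> S t) \<in> Q" using \<Theta>[OF zero_in_adm_\<beta> p] by blast
      with Q have "\<Theta> *v \<Psi> S t \<in> interior (control_set S)" by blast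
      then show "\<Theta> *v \<Psi> S t \<in> control_set S" by (rule subsetD[OF interior_subset])
    qed
    fix z assume "z \<in> scenarios"
    then show "endpoints \<Theta> z \<in> interior target"
      using \<Theta> Q by (cases z) (auto simp: endpoints_def interior_Times)
  qed
qed

lemma robust_feasible_nonempty: "robust_feasible S xbar \<noteq> {}"
proof -
  obtain \<Theta> where \<Theta>: "\<Theta> \<in> adm_\<Theta> S" "\<And>z. z \<in> scenarios \<Longrightarrow> endpoints \<Theta> z \<in> interior target"
    using slater_point by blast
  have "\<Theta> \<in> robust_feasible S xbar" unfolding robust_feasible_eq feasible_for_def
    using \<Theta> interior_subset[of target] by blast
  then show ?thesis by blast
qed

lemma G_continuous:
  "continuous_on (index_set S) (\<lambda>(ts :: real^'D, bs, ps). G S xbar \<epsilon> ts bs ps)"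
proof -
  obtain \<Theta>s where \<Theta>s: "\<Theta>s \<in> adm_\<Theta> S" "\<And>z. z \<in> scenarios \<Longrightarrow> endpoints \<Theta>s z \<in> interior target"
    using slater_point by blast
  define y where "y i \<Theta> z = endpoints \<Theta> (fst z $ i, fst (snd z) $ i, snd (snd z) $ i)"
    for i :: 'D and \<Theta> and z :: "(real^'D) \<times> ((real^'M^'d)^'D) \<times> ((real^'v)^'D)"
  have sc: "(fst z $ i, fst (snd z) $ i, snd (snd z) $ i) \<in> scenarios"
    if "z \<in> index_set S" for z :: "(real^'D) \<times> ((real^'M^'d)^'D) \<times> ((real^'v)^'D)" and i
    using that by (cases z) (auto simp: index_set_def)
  have "continuous_on (index_set S)
      (\<lambda>z. INF \<Theta>\<in>{\<Theta> \<in> adm_\<Theta> S. \<forall>i. y i \<Theta> z \<in> target}. ereal (reg_cost S \<epsilon> \<Theta>))"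
  proof (rule value_function_continuous[OF compact_adm_\<Theta> convex_adm_\<Theta> continuous_on_reg_cost target _ _ \<Theta>s(1)])
    fix i :: 'D
    have "continuous_on (adm_\<Theta> S \<times> index_set S)
        (\<lambda>x. (\<lambda>(\<Theta>, z). endpoints \<Theta> z)
          (fst x, fst (snd x) $ i, fst (snd (snd x)) $ i, snd (snd (snd x)) $ i))"
      by (rule continuous_on_compose2[OF continuous_on_endpoints])
        (use sc in \<open>auto intro!: continuous_intros simp: index_set_def\<close>)
    then show "continuous_on (adm_\<Theta> S \<times> index_set S) (\<lambda>(\<Theta>, z). y i \<Theta> z)"
      by (simp add: y_def split_beta)
    show "y i \<Theta>s z \<in> interior target" if "z \<in> index_set S" for z
      unfolding y_def by (rule \<Theta>s(2)[OF sc[OF that]])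
    show "y i ((1 - u) *\<^sub>R \<Theta> + u *\<^sub>R \<Theta>') z = (1 - u) *\<^sub>R y i \<Theta> z + u *\<^sub>R y i \<Theta>' z"
      if "z \<in> index_set S" for \<Theta> \<Theta>' z u
      unfolding y_def by (rule endpoints_convex_comb[OF sc[OF that]])
  qed
  then show ?thesis
    by (rule continuous_on_eq) (auto simp: G_def relaxed_feasible_eq y_def)
qed

lemma compact_index_set: "compact (index_set S :: ((real^'D) \<times> ((real^'M^'d)^'D) \<times> ((real^'v)^'D)) set)"
proof -
  have "(index_set S :: ((real^'D) \<times> ((real^'M^'d)^'D) \<times> ((real^'v)^'D)) set) =
      {v. \<forall>i. v $ i \<in> {0..T}} \<times> {v. \<forall>i. v $ i \<in> adm_\<beta> S} \<times> {v. \<forall>i. v $ i \<in> params S}"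
    by (auto simp: index_set_def)
  then show ?thesis using wp compact_adm_\<beta>
    by (simp only:) (intro compact_Times compact_vec_box; simp)
qed

lemma index_set_nonempty: "(index_set S :: ((real^'D) \<times> ((real^'M^'d)^'D) \<times> ((real^'v)^'D)) set) \<noteq> {}"
proof -
  obtain t \<beta> p where "t \<in> {0..T}" "\<beta> \<in> adm_\<beta> S" "p \<in> params S" using scenarios_nonempty by auto
  then have "(\<chi> i. t, \<chi> i. \<beta>, \<chi> i. p) \<in> index_set S" by (simp add: index_set_def)
  then show ?thesis by blast
qed

lemma relaxed_argmin:
  assumes "(ts, bs, ps) \<in> index_set S"
  obtains \<Theta> where "is_arg_min (reg_cost S \<epsilon>) (\<lambda>\<Theta>. \<Theta> \<in> relaxed_feasible S xbar ts bs ps) \<Theta>"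
    "G S xbar \<epsilon> ts bs ps = ereal (reg_cost S \<epsilon> \<Theta>)"
proof -
  have ne: "relaxed_feasible S xbar ts bs ps \<noteq> {}"
    using robust_subset_relaxed[OF assms] robust_feasible_nonempty by blast
  obtain \<Theta> where \<Theta>: "is_arg_min (reg_cost S \<epsilon>) (\<lambda>\<Theta>. \<Theta> \<in> relaxed_feasible S xbar ts bs ps) \<Theta>"
    by (rule exE[OF argmin_exists[OF relaxed_feasible_compact_convex(1)[OF assms] ne continuous_on_reg_cost]])
  show ?thesis by (rule that[OF \<Theta>]) (simp add: G_def INF_eq_argmin[OF \<Theta>])
qed

lemma robust_argmin:
  obtains \<Theta> where "is_arg_min (reg_cost S \<epsilon>) (\<lambda>\<Theta>. \<Theta> \<in> robust_feasible S xbar) \<Theta>"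
    "V S xbar \<epsilon> = ereal (reg_cost S \<epsilon> \<Theta>)"
proof -
  obtain \<Theta> where \<Theta>: "is_arg_min (reg_cost S \<epsilon>) (\<lambda>\<Theta>. \<Theta> \<in> robust_feasible S xbar) \<Theta>"
    by (rule exE[OF argmin_exists[OF robust_feasible_compact_convex(1) robust_feasible_nonempty
            continuous_on_reg_cost]])
  show ?thesis by (rule that[OF \<Theta>]) (simp add: V_def INF_eq_argmin[OF \<Theta>])
qed

lemma solves_max_exists: "\<exists>(ts :: real^'D) bs ps. solves_max S xbar \<epsilon> ts bs ps"
proof -
  let ?G = "\<lambda>(ts :: real^'D, bs, ps). G S xbar \<epsilon> ts bs ps"
  have "\<exists>z\<in>index_set S. \<forall>z'\<in>index_set S. ?G z' \<le> ?G z"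
    by (rule continuous_attains_sup[OF compact_index_set index_set_nonempty G_continuous])
  then obtain z where z: "z \<in> index_set S" "\<forall>z'\<in>index_set S. ?G z' \<le> ?G z" by (rule bexE)
  obtain ts bs ps where "z = (ts, bs, ps)" by (rule prod_cases3)
  with z have "solves_max S xbar \<epsilon> ts bs ps"
    unfolding solves_max_def is_arg_max_def by (meson leD)
  then show ?thesis by blast
qed

lemma solves_maxD:
  fixes ts ts' :: "real^'D"
  assumes "solves_max S xbar \<epsilon> ts bs ps"
  shows "(ts, bs, ps) \<in> index_set S"
    and "(ts', bs', ps') \<in> index_set S \<Longrightarrow> G S xbar \<epsilon> ts' bs' ps' \<le> G S xbar \<epsilon> ts bs ps"
proof -
  let ?G = "\<lambda>(t :: real^'D, b, p). G S xbar \<epsilon> t b p"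
  have max: "\<not> (\<exists>z'. z' \<in> index_set S \<and> ?G (ts, bs, ps) < ?G z')"
    using assms unfolding solves_max_def is_arg_max_def by (rule conjunct2)
  show "(ts, bs, ps) \<in> index_set S" using assms unfolding solves_max_def is_arg_max_def by blast
  show "G S xbar \<epsilon> ts' bs' ps' \<le> G S xbar \<epsilon> ts bs ps" if "(ts', bs', ps') \<in> index_set S"
    using max that by (auto simp: not_less)
qed

text \<open>
  No relaxed program has a larger value than \<open>g\<close>, the value at the maximiser, so the sublevel
  set of the cost at \<open>g\<close> meets all constraint sets simultaneously, by Helly's theorem.
\<close>

lemma V_eq_max_G:
  fixes ts :: "real^'D"
  assumes D: "CARD('D) = CARD('m) * CARD('N)" and \<epsilon>: "0 < \<epsilon>"
    and max: "solves_max S xbar \<epsilon> ts bs ps"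
  shows "V S xbar \<epsilon> = G S xbar \<epsilon> ts bs ps"
proof (rule antisym)
  note z = solves_maxD(1)[OF max]
  obtain \<Theta>m where "G S xbar \<epsilon> ts bs ps = ereal (reg_cost S \<epsilon> \<Theta>m)" by (rule relaxed_argmin[OF z])
  then obtain g where g: "G S xbar \<epsilon> ts bs ps = ereal g" by blast
  define L where "L = {\<Theta> \<in> adm_\<Theta> S. reg_cost S \<epsilon> \<Theta> \<le> g}"
  have "L \<inter> (\<Inter>z\<in>scenarios. feasible_for z) \<noteq> {}"
  proof (rule semi_infinite_helly[where 'D = 'D])
    show "CARD('D) = DIM(real^'N^'m)" using D by simp
    show "scenarios \<noteq> {}" by (rule scenarios_nonempty)
    have "closed (adm_\<Theta> S \<inter> reg_cost S \<epsilon> -` {..g})"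
      by (intro continuous_closed_preimage continuous_on_reg_cost closed_atMost
          compact_imp_closed[OF compact_adm_\<Theta>])
    then have "compact (adm_\<Theta> S \<inter> (adm_\<Theta> S \<inter> reg_cost S \<epsilon> -` {..g}))"
      by (rule compact_Int_closed[OF compact_adm_\<Theta>])
    moreover have "adm_\<Theta> S \<inter> (adm_\<Theta> S \<inter> reg_cost S \<epsilon> -` {..g}) = L" by (auto simp: L_def)
    ultimately show "compact L" by simp
    show "convex L" unfolding L_def by (rule convex_sublevel[OF convex_on_reg_cost[OF \<epsilon> convex_adm_\<Theta>]])
    show "(\<Inter>z\<in>scenarios. feasible_for z) \<noteq> {}"
      using robust_feasible_nonempty unfolding robust_feasible_eq .
    fix k :: "'D \<Rightarrow> real \<times> (real^'M^'d) \<times> (real^'v)" assume k: "range k \<subseteq> scenarios"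
    define ts' bs' ps' where "ts' = (\<chi> i. fst (k i))" and "bs' = (\<chi> i. fst (snd (k i)))"
      and "ps' = (\<chi> i. snd (snd (k i)))"
    have ki: "k i = (ts' $ i, bs' $ i, ps' $ i)" for i by (simp add: ts'_def bs'_def ps'_def)
    have z': "(ts', bs', ps') \<in> index_set S"
      using k unfolding index_set_def by (simp add: image_subset_iff ki)
    obtain \<Theta> where \<Theta>: "is_arg_min (reg_cost S \<epsilon>) (\<lambda>\<Theta>. \<Theta> \<in> relaxed_feasible S xbar ts' bs' ps') \<Theta>"
      "G S xbar \<epsilon> ts' bs' ps' = ereal (reg_cost S \<epsilon> \<Theta>)" by (rule relaxed_argmin[OF z'])
    then have "reg_cost S \<epsilon> \<Theta> \<le> g" using solves_maxD(2)[OF max z'] g by simp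
    moreover have "\<Theta> \<in> relaxed_feasible S xbar ts' bs' ps'" using \<Theta>(1) by (simp add: is_arg_min_def)
    then have "\<Theta> \<in> adm_\<Theta> S" "\<And>i. \<Theta> \<in> feasible_for (k i)"
      using relaxed_feasible_eq[OF z'] by (auto simp: feasible_for_def ki)
    ultimately show "L \<inter> (\<Inter>i. feasible_for (k i)) \<noteq> {}" by (auto simp: L_def)
  qed (use feasible_for_closed_convex in blast)+
  then obtain \<Theta> where "\<Theta> \<in> robust_feasible S xbar" "reg_cost S \<epsilon> \<Theta> \<le> g"
    unfolding robust_feasible_eq L_def by blast
  then show "V S xbar \<epsilon> \<le> G S xbar \<epsilon> ts bs ps"
    unfolding V_def g by (intro INF_lower2[of \<Theta>]) auto
  show "G S xbar \<epsilon> ts bs ps \<le> V S xbar \<epsilon>"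
    unfolding V_def G_def by (intro INF_superset_mono robust_subset_relaxed z) simp
qed

text \<open>
  A robust minimiser is feasible for the relaxed program and attains its optimal value, hence is
  its unique minimiser.
\<close>

lemma relaxed_argmin_is_robust_argmin:
  fixes ts :: "real^'D"
  assumes D: "CARD('D) = CARD('m) * CARD('N)" and \<epsilon>: "0 < \<epsilon>"
    and max: "solves_max S xbar \<epsilon> ts bs ps"
    and \<Theta>: "is_arg_min (reg_cost S \<epsilon>) (\<lambda>\<Theta>. \<Theta> \<in> relaxed_feasible S xbar ts bs ps) \<Theta>"
  shows "is_arg_min (reg_cost S \<epsilon>) (\<lambda>\<Theta>. \<Theta> \<in> robust_feasible S xbar) \<Theta>"
proof -
  note z = solves_maxD(1)[OF max]
  obtain \<Theta>r where r: "is_arg_min (reg_cost S \<epsilon>) (\<lambda>\<Theta>. \<Theta> \<in> robust_feasible S xbar) \<Theta>r"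
    "V S xbar \<epsilon> = ereal (reg_cost S \<epsilon> \<Theta>r)" by (rule robust_argmin)
  have "reg_cost S \<epsilon> \<Theta>r = reg_cost S \<epsilon> \<Theta>"
    using V_eq_max_G[OF D \<epsilon> max] r(2) INF_eq_argmin[OF \<Theta>] by (simp add: G_def)
  moreover have "\<Theta>r \<in> relaxed_feasible S xbar ts bs ps"
    using r(1) robust_subset_relaxed[OF z] by (auto simp: is_arg_min_def)
  ultimately have "is_arg_min (reg_cost S \<epsilon>) (\<lambda>\<Theta>. \<Theta> \<in> relaxed_feasible S xbar ts bs ps) \<Theta>r"
    using \<Theta> by (simp add: is_arg_min_def)
  then have "\<Theta>r = \<Theta>"
    by (rule strictly_convex_argmin_unique[OF strictly_convex_reg_cost[OF \<epsilon>] relaxed_feasible_compact_convex(2)[OF z] _ \<Theta>])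
  with r(1) show ?thesis by simp
qed

end

section \<open>The maximisation problem, exactness and vanishing regularization\<close>

theorem mainTheorem2:
  fixes S :: "('d::finite, 'm::finite, 'v::finite, 'N::finite, 'M::finite) control_problem"
    and xbar :: "real^'d"
  assumes "well_posed S"
    and "CARD('D::finite) = CARD('m) * CARD('N)"
    and "\<forall>\<epsilon>>0. xbar \<in> feasible_states S \<epsilon>"
    and "strictly_feasible S xbar"
  shows
    "(\<forall>\<epsilon>>0.
        continuous_on (index_set S :: ((real^'D) \<times> ((real^'M^'d)^'D) \<times> ((real^'v)^'D)) set)
          (\<lambda>(ts, bs, ps). G S xbar \<epsilon> ts bs ps) \<and>
        (\<forall>(ts, bs, ps) \<in> (index_set S :: ((real^'D) \<times> ((real^'M^'d)^'D) \<times> ((real^'v)^'D)) set).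
          \<bar>G S xbar \<epsilon> ts bs ps\<bar> \<noteq> \<infinity>) \<and>
        (\<exists>(ts :: real^'D) bs ps. solves_max S xbar \<epsilon> ts bs ps))
     \<and>
     (\<forall>\<epsilon>>0. \<forall>(ts :: real^'D) bs ps.
        solves_max S xbar \<epsilon> ts bs ps \<longrightarrow> V S xbar \<epsilon> = G S xbar \<epsilon> ts bs ps)
     \<and>
     (\<forall>(ts :: real \<Rightarrow> real^'D) bs ps.
        (\<forall>\<epsilon>>0. solves_max S xbar \<epsilon> (ts \<epsilon>) (bs \<epsilon>) (ps \<epsilon>)) \<longrightarrow>
        (\<forall>\<epsilon>>0. \<exists>!\<Theta>. is_arg_min (reg_cost S \<epsilon>)
           (\<lambda>\<Theta>. \<Theta> \<in> relaxed_feasible S xbar (ts \<epsilon>) (bs \<epsilon>) (ps \<epsilon>)) \<Theta>) \<and>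
        (\<forall>\<Theta>s :: real \<Rightarrow> real^'N^'m.
           (\<forall>\<epsilon>>0. is_arg_min (reg_cost S \<epsilon>)
              (\<lambda>\<Theta>. \<Theta> \<in> relaxed_feasible S xbar (ts \<epsilon>) (bs \<epsilon>) (ps \<epsilon>)) (\<Theta>s \<epsilon>)) \<longrightarrow>
           (\<exists>\<Theta>0. is_arg_min (cost S) (\<lambda>\<Theta>. \<Theta> \<in> robust_feasible S xbar) \<Theta>0 \<and>
              (\<Theta>s \<longlongrightarrow> \<Theta>0) (at_right 0))))"
proof -
  interpret strictly_feasible_problem S xbar
    using assms(1,4) by unfold_locales
  note D = assms(2)
  show ?thesis
  proof (intro conjI allI impI)
    fix \<epsilon> :: real
    show "continuous_on (index_set S :: ((real^'D) \<times> ((real^'M^'d)^'D) \<times> ((real^'v)^'D)) set)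
        (\<lambda>(ts, bs, ps). G S xbar \<epsilon> ts bs ps)"
      by (rule G_continuous)
    show "\<forall>(ts, bs, ps) \<in> (index_set S :: ((real^'D) \<times> ((real^'M^'d)^'D) \<times> ((real^'v)^'D)) set).
        \<bar>G S xbar \<epsilon> ts bs ps\<bar> \<noteq> \<infinity>"
    proof clarify
      fix ts :: "real^'D" and bs ps
      assume "(ts, bs, ps) \<in> index_set S" and inf: "\<bar>G S xbar \<epsilon> ts bs ps\<bar> = \<infinity>"
      then obtain \<Theta> where "G S xbar \<epsilon> ts bs ps = ereal (reg_cost S \<epsilon> \<Theta>)"
        using relaxed_argmin by blast
      with inf show False by simp
    qed
    show "\<exists>(ts :: real^'D) bs ps. solves_max S xbar \<epsilon> ts bs ps" by (rule solves_max_exists)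
  next
    fix \<epsilon> :: real and ts :: "real^'D" and bs ps
    assume "0 < \<epsilon>" "solves_max S xbar \<epsilon> ts bs ps"
    then show "V S xbar \<epsilon> = G S xbar \<epsilon> ts bs ps" by (rule V_eq_max_G[OF D])
  next
    fix ts :: "real \<Rightarrow> real^'D" and bs ps and \<epsilon> :: real
    assume "\<forall>\<epsilon>>0. solves_max S xbar \<epsilon> (ts \<epsilon>) (bs \<epsilon>) (ps \<epsilon>)" and \<epsilon>: "0 < \<epsilon>"
    then have z: "(ts \<epsilon>, bs \<epsilon>, ps \<epsilon>) \<in> index_set S" using solves_maxD(1) by blast
    then obtain \<Theta> where \<Theta>: "is_arg_min (reg_cost S \<epsilon>)
        (\<lambda>\<Theta>. \<Theta> \<in> relaxed_feasible S xbar (ts \<epsilon>) (bs \<epsilon>) (ps \<epsilon>)) \<Theta>"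
      by (rule relaxed_argmin)
    show "\<exists>!\<Theta>. is_arg_min (reg_cost S \<epsilon>)
        (\<lambda>\<Theta>. \<Theta> \<in> relaxed_feasible S xbar (ts \<epsilon>) (bs \<epsilon>) (ps \<epsilon>)) \<Theta>"
      by (rule ex1I, rule \<Theta>)
        (rule strictly_convex_argmin_unique[OF strictly_convex_reg_cost[OF \<epsilon>]
          relaxed_feasible_compact_convex(2)[OF z] _ \<Theta>])
  next
    fix ts :: "real \<Rightarrow> real^'D" and bs ps and \<Theta>s :: "real \<Rightarrow> real^'N^'m"
    assume max: "\<forall>\<epsilon>>0. solves_max S xbar \<epsilon> (ts \<epsilon>) (bs \<epsilon>) (ps \<epsilon>)"
      and \<Theta>s: "\<forall>\<epsilon>>0. is_arg_min (reg_cost S \<epsilon>)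
        (\<lambda>\<Theta>. \<Theta> \<in> relaxed_feasible S xbar (ts \<epsilon>) (bs \<epsilon>) (ps \<epsilon>)) (\<Theta>s \<epsilon>)"
    show "\<exists>\<Theta>0. is_arg_min (cost S) (\<lambda>\<Theta>. \<Theta> \<in> robust_feasible S xbar) \<Theta>0 \<and> (\<Theta>s \<longlongrightarrow> \<Theta>0) (at_right 0)"
    proof (rule tikhonov_convergence[where R = "regularizer S"])
      fix \<epsilon> :: real assume \<epsilon>: "0 < \<epsilon>"
      show "is_arg_min (\<lambda>\<Theta>. cost S \<Theta> + \<epsilon> * regularizer S \<Theta>) (\<lambda>\<Theta>. \<Theta> \<in> robust_feasible S xbar) (\<Theta>s \<epsilon>)"
        using relaxed_argmin_is_robust_argmin[OF D \<epsilon> max[rule_format, OF \<epsilon>] \<Theta>s[rule_format, OF \<epsilon>]]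
        unfolding reg_cost_def[abs_def] .
    next
      show "convex_on (robust_feasible S xbar) (cost S)"
        by (rule convex_on_subset[OF cost_convex subset_UNIV robust_feasible_compact_convex(2)])
      have "continuous_on UNIV (regularizer S)" using wp by blast
      then show "continuous_on (robust_feasible S xbar) (regularizer S)"
        by (rule continuous_on_subset) simp
      show "strictly_convex (regularizer S)" "\<And>\<Theta>. 0 < regularizer S \<Theta>" using wp by blast+
    qed (intro robust_feasible_compact_convex robust_feasible_nonempty continuous_on_cost)+
  qed
qed

end
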